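(* There exists a Carnot group that is not discretizable.
   Context: A Carnot group $G$ is a simply connected Lie group whose Lie algebra is stratified: $\mathfrak{g}=\bigoplus_{j=1}^r \mathcal{V}_j$ with $[\mathcal{V}_1,\mathcal{V}_j]=\mathcal{V}_{j+1}$ for $j\ge1$ (with $\mathcal{V}_k=0$ for $k>r$). Let $m_j=\dim\mathcal{V}_j$. $G$ is called discretizable if for each $j\in\{1,\dots,r\}$ there is a collection of vectors $\{X_{(j,i)}\}_{i=1}^{m_j}\subset\mathcal{V}_j$ spanning $\mathcal{V}_j$ such that, setting $G'=\langle\{\exp(X_{(1,i)})\}_{i=1}^{m_1}\rangle$ (the subgroup generated by these elements) and $G_j=\exp\big(\bigoplus_{k=j}^r\mathcal{V}_k\big)$, the group $G'$ is a discrete subgroup of $G$ and for each $j\in\{1,\dots,r\}$ $$G'\cap G_j=\big\langle\{\exp(X_{(k,i)})\}_{1\le i\le m_k,\ j\le k\le r}\big\rangle .$$ *)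

theory Defs
  imports "HOL-Analysis.Analysis" "HOL-Algebra.Generated_Groups" "HOL-Library.Function_Algebras"
begin

text \<open>Points of \<open>\<real>\<^sup>n\<close> are functions \<open>nat \<Rightarrow> real\<close> vanishing from index \<open>n\<close> on, as in
  \<^const>\<open>Euclidean_space\<close>, so that the dimension is an ordinary natural number.
  For \<open>S\<close> open in \<open>\<real>\<^sup>n\<close>, \<open>Ck_on n k S f\<close> says that all iterated partial derivatives of \<open>f\<close> of
  order at most \<open>k\<close> exist and are continuous on \<open>S\<close>.\<close>

primrec Ck_on :: "nat \<Rightarrow> nat \<Rightarrow> (nat \<Rightarrow> real) set \<Rightarrow> ((nat \<Rightarrow> real) \<Rightarrow> real) \<Rightarrow> bool" where
  "Ck_on n 0 S f \<longleftrightarrow> continuous_on S f"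
| "Ck_on n (Suc k) S f \<longleftrightarrow> continuous_on S f \<and>
     (\<forall>i<n. \<exists>g. (\<forall>x\<in>S. ((\<lambda>t. f (x(i := t))) has_real_derivative g x) (at (x i))) \<and> Ck_on n k S g)"

definition smooth_on :: "nat \<Rightarrow> (nat \<Rightarrow> real) set \<Rightarrow> ((nat \<Rightarrow> real) \<Rightarrow> real) \<Rightarrow> bool" where
  "smooth_on n S f \<longleftrightarrow> (\<forall>k. Ck_on n k S f)"

text \<open>A chart is a pair of its domain and its coordinate map; the atlas need not be maximal.\<close>

record 'a manifold =
  mtop :: "'a topology"
  mdim :: nat
  matlas :: "('a set \<times> ('a \<Rightarrow> nat \<Rightarrow> real)) set"

definition smooth_manifold :: "'a manifold \<Rightarrow> bool" where
  "smooth_manifold M \<longleftrightarrow>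
     Hausdorff_space (mtop M) \<and> second_countable (mtop M) \<and>
     (\<forall>(U, \<phi>) \<in> matlas M.
        openin (mtop M) U \<and> openin (Euclidean_space (mdim M)) (\<phi> ` U) \<and>
        homeomorphic_map (subtopology (mtop M) U) (subtopology (Euclidean_space (mdim M)) (\<phi> ` U)) \<phi>) \<and>
     (\<Union>(U, \<phi>) \<in> matlas M. U) = topspace (mtop M) \<and>
     (\<forall>(U, \<phi>) \<in> matlas M. \<forall>(V, \<psi>) \<in> matlas M. \<forall>j < mdim M.
        smooth_on (mdim M) (\<phi> ` (U \<inter> V)) (\<lambda>x. \<psi> (inv_into U \<phi> x) j))"

definition smooth_map :: "'a manifold \<Rightarrow> 'b manifold \<Rightarrow> ('a \<Rightarrow> 'b) \<Rightarrow> bool" where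
  "smooth_map M N f \<longleftrightarrow>
     continuous_map (mtop M) (mtop N) f \<and>
     (\<forall>(U, \<phi>) \<in> matlas M. \<forall>(V, \<psi>) \<in> matlas N. \<forall>j < mdim N.
        smooth_on (mdim M) (\<phi> ` (U \<inter> f -` V)) (\<lambda>x. \<psi> (f (inv_into U \<phi> x)) j))"

definition prod_manifold :: "'a manifold \<Rightarrow> 'b manifold \<Rightarrow> ('a \<times> 'b) manifold" where
  "prod_manifold M N =
     \<lparr>mtop = prod_topology (mtop M) (mtop N),
      mdim = mdim M + mdim N,
      matlas = {(U \<times> V, \<lambda>(p, q) i. if i < mdim M then \<phi> p i else \<psi> q (i - mdim M)) | U \<phi> V \<psi>.
                  (U, \<phi>) \<in> matlas M \<and> (V, \<psi>) \<in> matlas N}\<rparr>"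

definition real_manifold :: "real manifold" where
  "real_manifold =
     \<lparr>mtop = euclideanreal, mdim = 1, matlas = {(UNIV, \<lambda>t i. if i = 0 then t else 0)}\<rparr>"

text \<open>The algebra of smooth real functions; the value \<open>0\<close> off the manifold makes each of its
  elements a unique HOL function.\<close>

definition smooth_funs :: "'a manifold \<Rightarrow> ('a \<Rightarrow> real) set" where
  "smooth_funs M = {f. smooth_map M real_manifold f \<and> (\<forall>p. p \<notin> topspace (mtop M) \<longrightarrow> f p = 0)}"

definition simply_connected_space :: "'a topology \<Rightarrow> bool" where
  "simply_connected_space X \<longleftrightarrow>
     path_connected_space X \<and>
     (\<forall>p. pathin X p \<and> p 1 = p 0 \<longrightarrow>
        homotopic_with (\<lambda>h. h 0 = p 0 \<and> h 1 = p 0) (top_of_set {0..1}) X p (\<lambda>_. p 0))"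

definition lie_group :: "'a monoid \<Rightarrow> 'a manifold \<Rightarrow> bool" where
  "lie_group G M \<longleftrightarrow>
     group G \<and> smooth_manifold M \<and> topspace (mtop M) = carrier G \<and>
     smooth_map (prod_manifold M M) M (\<lambda>(x, y). x \<otimes>\<^bsub>G\<^esub> y) \<and>
     smooth_map M M (\<lambda>x. inv\<^bsub>G\<^esub> x)"

type_synonym 'a oper = "('a \<Rightarrow> real) \<Rightarrow> ('a \<Rightarrow> real)"

definition oper_scale :: "real \<Rightarrow> 'a oper \<Rightarrow> 'a oper" where
  "oper_scale c X = (\<lambda>f p. c * X f p)"

global_interpretation oper: vector_space "oper_scale :: real \<Rightarrow> 'a oper \<Rightarrow> 'a oper"
  by standard (simp_all add: oper_scale_def fun_eq_iff algebra_simps)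

text \<open>Vector fields are derivations of the algebra of smooth functions. As operators on all HOL
  functions they are normalised to be \<open>0\<close> off that algebra.\<close>

definition vector_field :: "'a manifold \<Rightarrow> 'a oper \<Rightarrow> bool" where
  "vector_field M X \<longleftrightarrow>
     (\<forall>f \<in> smooth_funs M. X f \<in> smooth_funs M) \<and>
     (\<forall>f. f \<notin> smooth_funs M \<longrightarrow> X f = (\<lambda>p. 0)) \<and>
     (\<forall>f \<in> smooth_funs M. \<forall>g \<in> smooth_funs M. \<forall>p. X (\<lambda>p. f p + g p) p = X f p + X g p) \<and>
     (\<forall>c. \<forall>f \<in> smooth_funs M. \<forall>p. X (\<lambda>p. c * f p) p = c * X f p) \<and>
     (\<forall>f \<in> smooth_funs M. \<forall>g \<in> smooth_funs M. \<forall>p. X (\<lambda>p. f p * g p) p = f p * X g p + g p * X f p)"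

definition left_translate :: "'a monoid \<Rightarrow> 'a \<Rightarrow> ('a \<Rightarrow> real) \<Rightarrow> 'a \<Rightarrow> real" where
  "left_translate G a f = (\<lambda>p. if p \<in> carrier G then f (a \<otimes>\<^bsub>G\<^esub> p) else 0)"

definition lie_algebra :: "'a monoid \<Rightarrow> 'a manifold \<Rightarrow> 'a oper set" where
  "lie_algebra G M =
     {X. vector_field M X \<and>
         (\<forall>a \<in> carrier G. \<forall>f \<in> smooth_funs M. X (left_translate G a f) = left_translate G a (X f))}"

definition lie_bracket :: "'a oper \<Rightarrow> 'a oper \<Rightarrow> 'a oper" where
  "lie_bracket X Y = (\<lambda>f p. X (Y f) p - Y (X f) p)"

definition one_parameter_subgroup :: "'a monoid \<Rightarrow> 'a manifold \<Rightarrow> 'a oper \<Rightarrow> (real \<Rightarrow> 'a) \<Rightarrow> bool" where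
  "one_parameter_subgroup G M X \<gamma> \<longleftrightarrow>
     smooth_map real_manifold M \<gamma> \<and>
     (\<forall>s t. \<gamma> (s + t) = \<gamma> s \<otimes>\<^bsub>G\<^esub> \<gamma> t) \<and>
     (\<forall>f \<in> smooth_funs M. ((\<lambda>t. f (\<gamma> t)) has_real_derivative X f \<one>\<^bsub>G\<^esub>) (at 0))"

text \<open>On a Lie group, every element \<open>X\<close> of the Lie algebra has exactly one one-parameter subgroup
  \<open>\<gamma>\<close> with \<open>\<gamma>'(0) = X\<close> at the identity, so the description below is proper there.\<close>

definition lie_exp :: "'a monoid \<Rightarrow> 'a manifold \<Rightarrow> 'a oper \<Rightarrow> 'a" where
  "lie_exp G M X = (THE \<gamma>. one_parameter_subgroup G M X \<gamma>) 1"

definition discrete_subgroup :: "'a set \<Rightarrow> 'a monoid \<Rightarrow> 'a manifold \<Rightarrow> bool" where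
  "discrete_subgroup H G M \<longleftrightarrow> subgroup H G \<and> subtopology (mtop M) H = discrete_topology H"

text \<open>The stratification, with its number \<open>r\<close> of layers, is part of the data of a Carnot group.
  A connected Lie group has at most continuum many points, so a carrier inside \<open>nat \<Rightarrow> real\<close>
  is available for every Carnot group up to isomorphism. Only the values \<open>V j\<close> with \<open>j \<ge> 1\<close> are relevant.\<close>

definition stratification :: "'a monoid \<Rightarrow> 'a manifold \<Rightarrow> nat \<Rightarrow> (nat \<Rightarrow> 'a oper set) \<Rightarrow> bool" where
  "stratification G M r V \<longleftrightarrow>
     (\<forall>j\<ge>1. oper.subspace (V j)) \<and>
     (\<forall>k>r. V k = {0}) \<and>
     oper.span (\<Union>j\<in>{1..r}. V j) = lie_algebra G M \<and>
     (\<forall>v. (\<forall>j\<in>{1..r}. v j \<in> V j) \<and> (\<Sum>j\<in>{1..r}. v j) = 0 \<longrightarrow> (\<forall>j\<in>{1..r}. v j = 0)) \<and>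
     (\<forall>j\<ge>1. oper.span {lie_bracket X Y | X Y. X \<in> V 1 \<and> Y \<in> V j} = V (j + 1))"

definition carnot_group :: "'a monoid \<Rightarrow> 'a manifold \<Rightarrow> nat \<Rightarrow> (nat \<Rightarrow> 'a oper set) \<Rightarrow> bool" where
  "carnot_group G M r V \<longleftrightarrow>
     lie_group G M \<and> simply_connected_space (mtop M) \<and> stratification G M r V"

definition discretizable :: "'a monoid \<Rightarrow> 'a manifold \<Rightarrow> nat \<Rightarrow> (nat \<Rightarrow> 'a oper set) \<Rightarrow> bool" where
  "discretizable G M r V \<longleftrightarrow>
     (\<exists>X :: nat \<Rightarrow> nat \<Rightarrow> 'a oper.
        (\<forall>j\<in>{1..r}. (\<forall>i\<in>{1..oper.dim (V j)}. X j i \<in> V j) \<and>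
                    oper.span {X j i | i. i \<in> {1..oper.dim (V j)}} = V j) \<and>
        (let G' = generate G {lie_exp G M (X 1 i) | i. i \<in> {1..oper.dim (V 1)}};
             Gs = (\<lambda>j. lie_exp G M ` oper.span (\<Union>k\<in>{j..r}. V k))
         in discrete_subgroup G' G M \<and>
            (\<forall>j\<in>{1..r}. G' \<inter> Gs j =
               generate G {lie_exp G M (X k i) | k i. k \<in> {j..r} \<and> i \<in> {1..oper.dim (V k)}})))"

end

theory Submission
  imports Defs
begin

text \<open>Take the free nilpotent Lie group of step 3 on two generators. Any two vectors \<open>p, q\<close> spanning
  \<open>V\<^sub>1\<close> are free generators of the Lie algebra, and the commutator of \<open>exp p\<close> and \<open>exp q\<close> is
  \<open>exp (z + [p, z] / 2 + [q, z] / 2)\<close> with \<open>z = [p, q]\<close>. If \<open>G' \<inter> G\<^sub>2\<close> were generated by \<open>exp s\<close> with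
  \<open>s \<in> V\<^sub>2\<close> together with elements of \<open>exp V\<^sub>3\<close>, then \<open>z\<close> would be an integral multiple of \<open>s\<close>. But the half-integers
  in the commutator force every element of \<open>G' \<inter> exp V\<^sub>2\<close> to be \<open>exp (k z)\<close> with \<open>k\<close> even, so that
  \<open>z\<close> would be an even multiple of itself.

  In exponential coordinates the group is \<open>\<real>\<^sup>5\<close> with a polynomial product. That its Lie algebra is no
  larger than expected follows from Hadamard's lemma: a derivation of the smooth functions is
  determined by its values on the coordinates.\<close>

section \<open>Partial derivatives and smooth functions\<close>

text \<open>In exponential coordinates \<open>lie_exp\<close> becomes the identity, so a group
  generated by exponentials is a set of vectors under a polynomial product. Of the central part of
  its elements only the component along \<open>[p, z]\<close> has to be followed. For exp (i p) exp
  (j q) c^k, with c the commutator, that component is i^2 j / 12 + k (1 + i) / 2, and general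
  elements differ from this by integers. At i = j = 0 it is k / 2 modulo 1, so a vanishing central
  part makes k even.

  The analytic obstacle is that smoothness is given by iterated partial derivatives, without a total
  derivative. Calculus therefore moves one coordinate at a time: an increment in one coordinate is
  the coordinate difference times an integral mean of the partial derivative, and this formula
  yields both Hadamard's lemma and the chain rule.\<close>

definition coord_space :: "nat \<Rightarrow> (nat \<Rightarrow> real) set" where
  "coord_space n = {x. \<forall>i\<ge>n. x i = 0}"

lemma Euclidean_space_eq: "Euclidean_space n = top_of_set (coord_space n)"
  by (simp add: Euclidean_space_def coord_space_def euclidean_product_topology)

lemma coord_space_upd [simp]: "x \<in> coord_space n \<Longrightarrow> i < n \<Longrightarrow> x(i := t) \<in> coord_space n"
  by (auto simp: coord_space_def)

lemma zero_in_coord_space [simp]: "(\<lambda>_. 0) \<in> coord_space n"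
  by (simp add: coord_space_def)

definition partial :: "nat \<Rightarrow> ((nat \<Rightarrow> real) \<Rightarrow> real) \<Rightarrow> (nat \<Rightarrow> real) \<Rightarrow> real" where
  "partial i f x = deriv (\<lambda>t. f (x(i := t))) (x i)"

abbreviation Ck :: "nat \<Rightarrow> nat \<Rightarrow> ((nat \<Rightarrow> real) \<Rightarrow> real) \<Rightarrow> bool" where
  "Ck n k \<equiv> Ck_on n k (coord_space n)"

abbreviation smooth :: "nat \<Rightarrow> ((nat \<Rightarrow> real) \<Rightarrow> real) \<Rightarrow> bool" where
  "smooth n \<equiv> smooth_on n (coord_space n)"

text \<open>Moving a coordinate below \<open>n\<close> stays inside the space, so difference
  quotients never see values outside it. This is what allows functions to be cut off to 0
  there.\<close>

lemma Ck_cong: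
  assumes "\<And>x. x \<in> coord_space n \<Longrightarrow> f x = g x" "Ck n k f"
  shows "Ck n k g"
proof (cases k)
  case 0
  then show ?thesis
    using assms continuous_on_cong[of "coord_space n" "coord_space n" f g] by simp
next
  case (Suc l)
  have "(\<lambda>t. f (x(i := t))) = (\<lambda>t. g (x(i := t)))" if "x \<in> coord_space n" "i < n" for x i
    using that assms by simp
  then show ?thesis
    using assms Suc continuous_on_cong[of "coord_space n" "coord_space n" f g] by simp
qed

lemma partial_eqI:
  assumes "((\<lambda>t. f (x(i := t))) has_real_derivative d) (at (x i))"
  shows "partial i f x = d"
  using assms by (simp add: partial_def DERIV_imp_deriv)

text \<open>Derivatives are unique, so the existential witness of \<open>Ck_on\<close> agrees on the
  space with \<open>partial i f\<close>; the canonical choice can then be carried through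
  inductions.\<close>

lemma Ck_Suc:
  "Ck n (Suc k) f \<longleftrightarrow> continuous_on (coord_space n) f \<and>
     (\<forall>i<n. (\<forall>x\<in>coord_space n. ((\<lambda>t. f (x(i := t))) has_real_derivative partial i f x) (at (x i)))
        \<and> Ck n k (partial i f))"
proof -
  have "((\<forall>x\<in>coord_space n. ((\<lambda>t. f (x(i := t))) has_real_derivative partial i f x) (at (x i)))
          \<and> Ck n k (partial i f))"
    if "\<forall>x\<in>coord_space n. ((\<lambda>t. f (x(i := t))) has_real_derivative g x) (at (x i))" "Ck n k g" for i g
  proof -
    have "partial i f x = g x" if "x \<in> coord_space n" for x
      using that \<open>\<forall>x\<in>_. _\<close> by (intro partial_eqI) auto
    then show ?thesis
      using that Ck_cong[of n g "partial i f" k] by auto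
  qed
  then show ?thesis
    by (simp add: Ck_on.simps) blast
qed

lemma Ck_continuous: "Ck n k f \<Longrightarrow> continuous_on (coord_space n) f"
  by (cases k) auto

lemma Ck_SucD: "Ck n (Suc k) f \<Longrightarrow> Ck n k f"
proof (induction k arbitrary: f)
  case (Suc k)
  then show ?case
    unfolding Ck_Suc[of n "Suc k"] Ck_Suc[of n k] by blast
qed simp

lemma Ck_SucI:
  assumes "continuous_on (coord_space n) f"
    and "\<And>i x. i < n \<Longrightarrow> x \<in> coord_space n \<Longrightarrow>
           ((\<lambda>t. f (x(i := t))) has_real_derivative g i x) (at (x i))"
    and "\<And>i. i < n \<Longrightarrow> Ck n k (g i)"
  shows "Ck n (Suc k) f"
  using assms by auto

lemma has_partial:
  assumes "Ck n (Suc k) f" "x \<in> coord_space n" "i < n"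
  shows "((\<lambda>t. f (x(i := t))) has_real_derivative partial i f (x(i := s))) (at s)"
proof -
  have "((\<lambda>t. f ((x(i:=s))(i := t))) has_real_derivative partial i f (x(i:=s))) (at ((x(i:=s)) i))"
    using assms Ck_Suc coord_space_upd by blast
  then show ?thesis by simp
qed

lemma has_partial_at:
  assumes "Ck n (Suc k) f" "x \<in> coord_space n" "i < n"
  shows "((\<lambda>t. f (x(i := t))) has_real_derivative partial i f x) (at (x i))"
  using has_partial[OF assms, of "x i"] by (simp only: fun_upd_triv)

lemma Ck_partial: "Ck n (Suc k) f \<Longrightarrow> i < n \<Longrightarrow> Ck n k (partial i f)"
  using Ck_Suc by blast

lemma Ck_const: "Ck n k (\<lambda>x. c)"
proof (induction k arbitrary: c)
  case (Suc k)
  show ?case by (rule Ck_SucI[where g="\<lambda>_ _. 0"]) (use Suc in auto)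
qed auto

lemma continuous_on_coord: "continuous_on S (\<lambda>x. x i :: real)"
  by (rule continuous_on_subset[OF continuous_on_product_coordinates]) simp

lemma Ck_coord: "Ck n k (\<lambda>x. x i)"
proof (cases k)
  case (Suc l)
  show ?thesis unfolding Suc
  proof (rule Ck_SucI[where g="\<lambda>j _. if i = j then 1 else 0"])
    fix j and x :: "nat \<Rightarrow> real"
    show "((\<lambda>t. (x(j := t)) i) has_real_derivative (if i = j then 1 else 0)) (at (x j))"
      by (cases "i = j") (auto intro!: derivative_eq_intros)
  qed (auto simp: Ck_const continuous_on_coord)
qed (auto simp: continuous_on_coord)

lemma Ck_add: "Ck n k f \<Longrightarrow> Ck n k g \<Longrightarrow> Ck n k (\<lambda>x. f x + g x)"
proof (induction k arbitrary: f g)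
  case (Suc k)
  show ?case
  proof (rule Ck_SucI[where g="\<lambda>i x. partial i f x + partial i g x"])
    fix i x assume "i < n" "x \<in> coord_space n"
    then show "((\<lambda>t. f (x(i := t)) + g (x(i := t))) has_real_derivative
       partial i f x + partial i g x) (at (x i))"
      using DERIV_add[OF has_partial_at[OF Suc.prems(1)] has_partial_at[OF Suc.prems(2)], of x i x i]
      by blast
  next
    fix i assume "i < n"
    then show "Ck n k (\<lambda>x. partial i f x + partial i g x)"
      by (intro Suc.IH Ck_partial[OF Suc.prems(1)] Ck_partial[OF Suc.prems(2)])
  qed (intro continuous_on_add Ck_continuous[OF Suc.prems(1)] Ck_continuous[OF Suc.prems(2)])
qed (simp add: continuous_on_add)

lemma Ck_mult: "Ck n k f \<Longrightarrow> Ck n k g \<Longrightarrow> Ck n k (\<lambda>x. f x * g x)"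
proof (induction k arbitrary: f g)
  case (Suc k)
  show ?case
  proof (rule Ck_SucI[where g="\<lambda>i x. partial i f x * g x + partial i g x * f x"])
    fix i x assume "i < n" "x \<in> coord_space n"
    then show "((\<lambda>t. f (x(i := t)) * g (x(i := t))) has_real_derivative
       partial i f x * g x + partial i g x * f x) (at (x i))"
      using DERIV_mult[OF has_partial_at[OF Suc.prems(1)] has_partial_at[OF Suc.prems(2)], of x i x i]
      by (simp only: fun_upd_triv)
  next
    fix i assume "i < n"
    then show "Ck n k (\<lambda>x. partial i f x * g x + partial i g x * f x)"
      by (intro Ck_add Suc.IH Ck_partial[OF Suc.prems(1)] Ck_partial[OF Suc.prems(2)]
          Ck_SucD[OF Suc.prems(1)] Ck_SucD[OF Suc.prems(2)])
  qed (intro continuous_on_mult Ck_continuous[OF Suc.prems(1)] Ck_continuous[OF Suc.prems(2)])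
qed (simp add: continuous_on_mult)

lemma Ck_sum: "(\<And>i. i \<in> I \<Longrightarrow> Ck n k (f i)) \<Longrightarrow> Ck n k (\<lambda>x. \<Sum>i\<in>I. f i x)"
  by (induction I rule: infinite_finite_induct) (auto intro!: Ck_const Ck_add)

text \<open>The weight \<open>s ^ m\<close> makes the family stable under partial differentiation: a derivative in
  direction \<open>i\<close> passes from \<open>m\<close> to \<open>Suc m\<close>.\<close>

definition slice_mean :: "nat \<Rightarrow> ((nat \<Rightarrow> real) \<Rightarrow> real) \<Rightarrow> nat \<Rightarrow> (nat \<Rightarrow> real) \<Rightarrow> real" where
  "slice_mean m f i x = integral (cbox 0 1) (\<lambda>s. s ^ m * f (x(i := s * x i)))"

lemma continuous_on_upd:
  assumes "continuous_on S f" "continuous_on S g"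
  shows "continuous_on S (\<lambda>x. (f x)(i := (g x :: real)))"
proof (rule continuous_on_coordinatewise_then_product)
  fix j
  show "continuous_on S (\<lambda>x. ((f x)(i := g x)) j)"
    using assms continuous_on_product_then_coordinatewise[OF assms(1)] by (cases "i = j") auto
qed

text \<open>The fundamental theorem of calculus along one coordinate segment. The factor next to
  \<open>b - a\<close> is an integral mean, which stays continuous in parameters, unlike a value at
  an intermediate point.\<close>

lemma slice_mvt:
  assumes "Ck n (Suc k) f" "x \<in> coord_space n" "i < n"
  shows "f (x(i := b)) - f (x(i := a)) =
           (b - a) * integral (cbox 0 1) (\<lambda>s. partial i f (x(i := a + s * (b - a))))"
proof -
  have "((\<lambda>s. (b - a) * partial i f (x(i := a + s * (b - a)))) has_integral
          f (x(i := a + 1 * (b - a))) - f (x(i := a + 0 * (b - a)))) {0..1}"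
  proof (rule fundamental_theorem_of_calculus)
    fix s
    have "((\<lambda>t. f (x(i := t))) has_real_derivative partial i f (x(i := a + s * (b - a)))) (at (a + s * (b - a)))"
      using has_partial[OF assms] .
    then have "((\<lambda>s. f (x(i := a + s * (b - a)))) has_real_derivative
       partial i f (x(i := a + s * (b - a))) * (b - a)) (at s within {0..1})"
      by (rule DERIV_chain2) (auto intro!: derivative_eq_intros)
    then show "((\<lambda>s. f (x(i := a + s * (b - a)))) has_vector_derivative
       (b - a) * partial i f (x(i := a + s * (b - a)))) (at s within {0..1})"
      by (simp add: has_real_derivative_iff_has_vector_derivative mult.commute)
  qed simp
  from integral_unique[OF this] show ?thesis
    by simp
qed

text \<open>The base point \<open>w x\<close> and the inserted coordinate \<open>r (x, s)\<close>
  are kept separate so that one lemma serves both the slice means, based at x itself, and the hybrid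
  points of the chain rule.\<close>

lemma continuous_on_param_integral:
  assumes "continuous_on (coord_space n) f" "continuous_on S w" "continuous_on (S \<times> {0..1}) r"
    and "\<And>x. x \<in> S \<Longrightarrow> w x \<in> coord_space n" "i < n"
  shows "continuous_on S (\<lambda>x. integral (cbox 0 1) (\<lambda>s. s ^ m * f ((w x)(i := r (x, s :: real)))))"
proof (rule integral_continuous_on_param)
  have "continuous_on (S \<times> {0..1}) (\<lambda>z. (w (fst z))(i := r z))"
    by (rule continuous_on_upd[OF continuous_on_compose2[OF assms(2)] assms(3)])
       (auto intro!: continuous_intros)
  then have "continuous_on (S \<times> {0..1}) (\<lambda>z. f ((w (fst z))(i := r z)))"
    by (rule continuous_on_compose2[OF assms(1)]) (use assms in auto)
  then show "continuous_on (S \<times> cbox 0 1) (\<lambda>(x, s). s ^ m * f ((w x)(i := r (x, s))))"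
    by (auto intro!: continuous_intros simp: split_beta)
qed

lemma continuous_slice_mean:
  assumes "continuous_on (coord_space n) f" "i < n"
  shows "continuous_on (coord_space n) (slice_mean m f i)"
proof -
  have "continuous_on (coord_space n \<times> {0..1::real}) (\<lambda>z. snd z * fst z i)"
    using continuous_on_compose2[OF continuous_on_coord[of UNIV i] continuous_on_fst[OF continuous_on_id]]
    by (auto intro!: continuous_intros)
  then show ?thesis
    using continuous_on_param_integral[OF assms(1) continuous_on_id, where r="\<lambda>z. snd z * fst z i" and i=i and m=m]
      assms(2)
    by (simp add: slice_mean_def[abs_def])
qed

lemma Ck_slice_mean:
  assumes "i < n"
  shows "Ck n k f \<Longrightarrow> Ck n k (slice_mean m f i)"
proof (induction k arbitrary: f m)
  case 0
  then show ?case using continuous_slice_mean assms by simp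
next
  case (Suc k)
  show ?case
  proof (rule Ck_SucI[where g="\<lambda>j. slice_mean (if j = i then Suc m else m) (partial j f) i"])
    show "continuous_on (coord_space n) (slice_mean m f i)"
      using Suc.prems assms continuous_slice_mean Ck_continuous by blast
  next
    fix j x assume j: "j < n" and x: "x \<in> coord_space n"
    let ?y = "\<lambda>t s. (x(j := t))(i := s * (x(j := t)) i)"
    \<comment> \<open>The inner derivative: rescaling coordinate i by s contributes a factor s in
      direction i only. Together with \<open>s ^ m\<close> it gives the exponent
      \<open>Suc m\<close>.\<close>
    let ?e = "\<lambda>s::real. if j = i then s else 1"
    have cont: "continuous_on (UNIV \<times> cbox 0 1) (\<lambda>(t, s). s ^ m * (?e s * g (?y t s)))"
      if "continuous_on (coord_space n) g" for g
    proof -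
      have upd: "continuous_on (UNIV \<times> cbox 0 1) (\<lambda>z. x(j := fst z))"
        by (intro continuous_on_upd continuous_on_mult continuous_on_const continuous_on_id continuous_on_fst)
      have "continuous_on (UNIV \<times> cbox 0 1) (\<lambda>z. ?y (fst z) (snd z))"
        by (rule continuous_on_upd[OF upd continuous_on_mult[OF continuous_on_snd[OF continuous_on_id]
              continuous_on_product_then_coordinatewise[OF upd]]])
      then have "continuous_on (UNIV \<times> cbox 0 1) (\<lambda>z. g (?y (fst z) (snd z)))"
        by (rule continuous_on_compose2[OF that]) (use x j assms in auto)
      then show ?thesis
        by (cases "j = i") (auto intro!: continuous_intros simp: split_beta)
    qed
    have "((\<lambda>t. integral (cbox 0 1) (\<lambda>s. s ^ m * f (?y t s))) has_real_derivative
       integral (cbox 0 1) (\<lambda>s. s ^ m * (?e s * partial j f (?y (x j) s)))) (at (x j) within UNIV)"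
    proof (rule leibniz_rule_field_derivative)
      fix t s :: real
      have "((\<lambda>t. f (?y t s)) has_real_derivative partial j f (?y t s) * ?e s) (at t)"
      proof (cases "j = i")
        case True
        have "((\<lambda>t. f (x(i := s * t))) has_real_derivative partial i f (x(i := s * t)) * s) (at t)"
          by (rule DERIV_chain2[OF has_partial[OF Suc.prems x assms]]) (auto intro!: derivative_eq_intros)
        then show ?thesis using True by simp
      next
        case False
        have "((\<lambda>t. f ((x(i := s * x i))(j := t))) has_real_derivative
                partial j f ((x(i := s * x i))(j := t))) (at t)"
          by (rule has_partial[OF Suc.prems _ j]) (use x assms in simp)
        moreover have "?y t s = (x(i := s * x i))(j := t)" for t
          using False by (auto simp: fun_eq_iff)
        ultimately show ?thesis using False by (simp only: if_False mult_1_right)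
      qed
      then show "((\<lambda>t. s ^ m * f (?y t s)) has_real_derivative s ^ m * (?e s * partial j f (?y t s))) (at t within UNIV)"
        by (auto intro!: derivative_eq_intros)
    next
      show "continuous_on (UNIV \<times> cbox 0 1) (\<lambda>(t, s). s ^ m * (?e s * partial j f (?y t s)))"
        by (rule cont[OF Ck_continuous[OF Ck_partial[OF Suc.prems j]]])
    next
      fix t
      have "continuous_on (cbox 0 1) (\<lambda>s. ?y t s)"
        by (intro continuous_on_upd continuous_on_mult continuous_on_const continuous_on_id continuous_on_fst)
      then have "continuous_on (cbox 0 1) (\<lambda>s. f (?y t s))"
        by (rule continuous_on_compose2[OF Ck_continuous[OF Suc.prems]]) (use x j assms in auto)
      then show "(\<lambda>s. s ^ m * f (?y t s)) integrable_on cbox 0 1"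
        by (intro integrable_continuous continuous_on_mult continuous_on_power continuous_on_id)
    qed auto
    moreover have "(\<lambda>s. s ^ m * (?e s * partial j f (?y (x j) s))) =
        (\<lambda>s. s ^ (if j = i then Suc m else m) * partial j f (x(i := s * x i)))"
      by (simp add: fun_eq_iff)
    ultimately show "((\<lambda>t. slice_mean m f i (x(j := t))) has_real_derivative
        slice_mean (if j = i then Suc m else m) (partial j f) i x) (at (x j))"
      unfolding slice_mean_def by (simp only: fun_upd_same if_True fun_upd_triv)
  next
    fix j assume "j < n"
    then show "Ck n k (slice_mean (if j = i then Suc m else m) (partial j f) i)"
      by (rule Suc.IH[OF Ck_partial[OF Suc.prems]])
  qed
qed

lemma slice_hadamard:
  assumes "Ck n (Suc k) f" "x \<in> coord_space n" "i < n"
  shows "f x = f (x(i := 0)) + x i * slice_mean 0 (partial i f) i x"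
  using slice_mvt[OF assms, of "x i" 0] by (simp add: slice_mean_def algebra_simps)

text \<open>The factor \<open>g t - g x\<close> vanishes at x, so continuity of \<open>q\<close>
  suffices: in Caratheodory's form of differentiability the slope of the product is the slope of
  \<open>g\<close> times \<open>q\<close>.\<close>

lemma DERIV_mult_vanishing:
  fixes g q :: "real \<Rightarrow> real"
  assumes "(g has_real_derivative a) (at x)" "isCont q x"
  shows "((\<lambda>t. (g t - g x) * q t) has_real_derivative a * q x) (at x)"
proof -
  obtain d where d: "\<forall>z. g z - g x = d z * (z - x)" "isCont d x" "d x = a"
    using assms(1) by (auto simp: CARAT_DERIV)
  then show ?thesis
    unfolding CARAT_DERIV using assms(2)
    by (intro exI[of _ "\<lambda>z. d z * q z"]) (auto intro: continuous_mult)
qed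

text \<open>The coordinates of \<open>g t0\<close> are replaced by those of \<open>g t\<close> one
  at a time. Each replacement changes f by \<open>g t l - g t0 l\<close> times a mean of
  \<open>partial l f\<close> that is continuous in t, and \<open>DERIV_mult_vanishing\<close>
  differentiates this product.\<close>

lemma chain_rule:
  assumes f: "Ck n (Suc k) f" and g: "\<And>t. g t \<in> coord_space n"
    and g': "\<And>j t. j < n \<Longrightarrow> ((\<lambda>t. g t j) has_real_derivative g' j t) (at t)"
  shows "((\<lambda>t. f (g t)) has_real_derivative (\<Sum>j<n. partial j f (g t0) * g' j t0)) (at t0)"
proof -
  define w where "w l t = (\<lambda>i. if i < l then g t i else g t0 i)" for l t
  have gcont: "continuous_on UNIV (\<lambda>t. g t j)" for j
  proof (cases "j < n")
    case True
    then show ?thesis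
      using g' DERIV_isCont by (blast intro: continuous_at_imp_continuous_on)
  next
    case False
    then show ?thesis using g by (simp add: coord_space_def)
  qed
  have w_in: "w l t \<in> coord_space n" for l t
    using g by (auto simp: w_def coord_space_def)
  have wcont: "continuous_on UNIV (w l)" for l
  proof (rule continuous_on_coordinatewise_then_product)
    show "continuous_on UNIV (\<lambda>t. w l t i)" for i
      by (cases "i < l") (simp_all add: w_def gcont)
  qed
  have "((\<lambda>t. f (w l t)) has_real_derivative (\<Sum>j<l. partial j f (g t0) * g' j t0)) (at t0)"
    if "l \<le> n" for l
    using that
  proof (induction l)
    case 0
    then show ?case by (simp add: w_def)
  next
    case (Suc l)
    then have l: "l < n" by simp
    define q where "q t = integral (cbox 0 1)
      (\<lambda>s. s ^ 0 * partial l f ((w l t)(l := g t0 l + s * (g t l - g t0 l))))" for t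
    have cont: "continuous_on (UNIV \<times> {0..1}) (\<lambda>z. g t0 l + snd z * (g (fst z) l - g t0 l))"
      by (intro continuous_on_add continuous_on_mult continuous_on_diff continuous_on_const
          continuous_on_snd continuous_on_id
          continuous_on_compose2[OF gcont continuous_on_fst[OF continuous_on_id]]) auto
    have "continuous_on UNIV q"
      unfolding q_def
      using continuous_on_param_integral[OF Ck_continuous[OF Ck_partial[OF f l]] wcont cont w_in l,
          where m=0] by simp
    then have "isCont q t0"
      by (simp add: continuous_on_eq_continuous_at)
    from DERIV_mult_vanishing[OF g'[OF l] this]
    have "((\<lambda>t. (g t l - g t0 l) * q t) has_real_derivative g' l t0 * q t0) (at t0)" .
    moreover have "q t0 = partial l f (g t0)"
    proof -
      have "w l t0 = g t0" by (auto simp: w_def)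
      then show ?thesis by (simp add: q_def)
    qed
    moreover have "f (w (Suc l) t) = f (w l t) + (g t l - g t0 l) * q t" for t
    proof -
      have "w (Suc l) t = (w l t)(l := g t l)" "(w l t)(l := g t0 l) = w l t"
        by (auto simp: w_def fun_eq_iff less_Suc_eq)
      then show ?thesis
        using slice_mvt[OF f w_in l, of l t "g t l" "g t0 l"] by (simp add: q_def)
    qed
    ultimately show ?case
      using DERIV_add[OF Suc.IH, of "\<lambda>t. (g t l - g t0 l) * q t" "g' l t0 * q t0"] l
      by (simp add: mult.commute)
  qed
  from this[of n] show ?thesis
  proof -
    have "w n t = g t" for t
      using g[of t] g[of t0] by (auto simp: w_def coord_space_def fun_eq_iff)
    then show ?thesis
      using \<open>n \<le> n \<Longrightarrow> _\<close> by simp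
  qed
qed

lemma has_partial_compose:
  assumes f: "Ck n (Suc k) f" and h: "\<And>x. x \<in> coord_space m \<Longrightarrow> h x \<in> coord_space n"
    and h': "\<And>j. j < n \<Longrightarrow> Ck m (Suc l) (\<lambda>x. h x j)"
    and x: "x \<in> coord_space m" "i < m"
  shows "((\<lambda>t. f (h (x(i := t)))) has_real_derivative
           (\<Sum>j<n. partial j f (h x) * partial i (\<lambda>x. h x j) x)) (at (x i))"
  using chain_rule[OF f, of "\<lambda>t. h (x(i := t))" "\<lambda>j t. partial i (\<lambda>x. h x j) (x(i := t))" "x i"]
    has_partial[OF h' x] h x by simp

lemma partial_compose:
  assumes "Ck n (Suc k) f" "\<And>x. x \<in> coord_space m \<Longrightarrow> h x \<in> coord_space n"
    "\<And>j. j < n \<Longrightarrow> Ck m (Suc l) (\<lambda>x. h x j)" "x \<in> coord_space m" "i < m"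
  shows "partial i (\<lambda>x. f (h x)) x = (\<Sum>j<n. partial j f (h x) * partial i (\<lambda>x. h x j) x)"
  by (rule partial_eqI) (rule has_partial_compose[OF assms])

lemma Ck_compose:
  assumes "Ck n k f" "\<And>x. x \<in> coord_space m \<Longrightarrow> h x \<in> coord_space n"
    "\<And>j. j < n \<Longrightarrow> Ck m k (\<lambda>x. h x j)"
  shows "Ck m k (\<lambda>x. f (h x))"
  using assms
proof (induction k arbitrary: f)
  case 0
  have "continuous_on (coord_space m) (\<lambda>x. h x j)" for j
  proof (cases "j < n")
    case False
    then have "h x j = 0" if "x \<in> coord_space m" for x
      using 0(2)[OF that] by (simp add: coord_space_def)
    then show ?thesis
      using continuous_on_cong[of "coord_space m" "coord_space m" "\<lambda>x. h x j" "\<lambda>_. 0"] by simp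
  qed (use 0 in simp)
  then have "continuous_on (coord_space m) h"
    by (rule continuous_on_coordinatewise_then_product)
  then show ?case
    using 0 continuous_on_compose2[of "coord_space n" f "coord_space m" h] by auto
next
  case (Suc k)
  have IH: "Ck m k (\<lambda>x. F (h x))" if "Ck n k F" for F
    using Suc.IH[OF that Suc.prems(2)] Ck_SucD[OF Suc.prems(3)] by blast
  show ?case
  proof (rule Ck_SucI)
    show "continuous_on (coord_space m) (\<lambda>x. f (h x))"
      by (rule Ck_continuous[OF IH[OF Ck_SucD[OF Suc.prems(1)]]])
  next
    fix i x assume "i < m" "x \<in> coord_space m"
    then show "((\<lambda>t. f (h (x(i := t)))) has_real_derivative
           (\<Sum>j<n. partial j f (h x) * partial i (\<lambda>x. h x j) x)) (at (x i))"
      using has_partial_compose[OF Suc.prems] by blast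
  next
    fix i assume i: "i < m"
    show "Ck m k (\<lambda>x. \<Sum>j<n. partial j f (h x) * partial i (\<lambda>x. h x j) x)"
      by (rule Ck_sum, rule Ck_mult[OF IH[OF Ck_partial[OF Suc.prems(1)]]
            Ck_partial[OF Suc.prems(3) i]]) auto
  qed
qed

section \<open>Closure properties of smooth functions and Hadamard's lemma\<close>

lemma smooth_Ck: "smooth n f \<Longrightarrow> Ck n k f"
  by (simp add: smooth_on_def)

lemma smooth_const [simp]: "smooth n (\<lambda>x. c)"
  by (simp add: smooth_on_def Ck_const)

lemma smooth_coord [simp]: "smooth n (\<lambda>x. x i)"
  by (simp add: smooth_on_def Ck_coord)

lemma smooth_add: "smooth n f \<Longrightarrow> smooth n g \<Longrightarrow> smooth n (\<lambda>x. f x + g x)"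
  by (simp add: smooth_on_def Ck_add)

lemma smooth_mult: "smooth n f \<Longrightarrow> smooth n g \<Longrightarrow> smooth n (\<lambda>x. f x * g x)"
  by (simp add: smooth_on_def Ck_mult)

lemma smooth_minus: "smooth n f \<Longrightarrow> smooth n (\<lambda>x. - f x)"
  using smooth_mult[OF smooth_const[of n "-1"]] by simp

lemma smooth_diff: "smooth n f \<Longrightarrow> smooth n g \<Longrightarrow> smooth n (\<lambda>x. f x - g x)"
  using smooth_add[OF _ smooth_minus] by simp

lemma smooth_sum: "(\<And>i. i \<in> I \<Longrightarrow> smooth n (f i)) \<Longrightarrow> smooth n (\<lambda>x. \<Sum>i\<in>I. f i x)"
  by (simp add: smooth_on_def Ck_sum)

lemma smooth_partial: "smooth n f \<Longrightarrow> i < n \<Longrightarrow> smooth n (partial i f)"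
  unfolding smooth_on_def using Ck_partial by blast

lemma smooth_cong:
  "(\<And>x. x \<in> coord_space n \<Longrightarrow> f x = g x) \<Longrightarrow> smooth n f \<longleftrightarrow> smooth n g"
  unfolding smooth_on_def using Ck_cong[of n f g] Ck_cong[of n g f] by metis

lemma smooth_compose:
  assumes "smooth n f" "\<And>x. x \<in> coord_space m \<Longrightarrow> h x \<in> coord_space n"
    "\<And>j. j < n \<Longrightarrow> smooth m (\<lambda>x. h x j)"
  shows "smooth m (\<lambda>x. f (h x))"
  unfolding smooth_on_def using Ck_compose[of n _ f m h] assms smooth_Ck by presburger

lemma smooth_continuous: "smooth n f \<Longrightarrow> continuous_on (coord_space n) f"
  using Ck_continuous smooth_Ck by blast

text \<open>Coordinates are set to 0 one after another, from index 0 upward, and the increments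
  telescope. Hence \<open>h i\<close> is a slice mean at the point with its first i coordinates
  erased, rather than a mean of \<open>partial i f\<close> over the ray to x.\<close>

lemma hadamard:
  assumes f: "smooth n f"
  obtains h where "\<And>i. i < n \<Longrightarrow> smooth n (h i)"
    "\<And>i. i < n \<Longrightarrow> h i (\<lambda>_. 0) = partial i f (\<lambda>_. 0)"
    "\<And>x. x \<in> coord_space n \<Longrightarrow> f x = f (\<lambda>_. 0) + (\<Sum>i<n. x i * h i x)"
proof
  define r where "r i x = (\<lambda>j. if j < i then 0 else x j)" for i and x :: "nat \<Rightarrow> real"
  let ?h = "\<lambda>i x. slice_mean 0 (partial i f) i (r i x)"
  have r: "r i x \<in> coord_space n" if "x \<in> coord_space n" for i x
    using that by (auto simp: r_def coord_space_def)
  show "smooth n (?h i)" if "i < n" for i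
  proof (rule smooth_compose[OF _ r])
    show "smooth n (slice_mean 0 (partial i f) i)"
      using Ck_slice_mean[OF that] smooth_partial[OF f that] by (simp add: smooth_on_def)
    show "smooth n (\<lambda>x. r i x j)" for j
      by (cases "j < i") (auto simp: r_def)
  qed
  show "?h i (\<lambda>_. 0) = partial i f (\<lambda>_. 0)" for i
  proof -
    have "(\<lambda>_. 0 :: real)(i := 0) = (\<lambda>_. 0)" by auto
    then show ?thesis by (simp add: r_def slice_mean_def)
  qed
  show "f x = f (\<lambda>_. 0) + (\<Sum>i<n. x i * ?h i x)" if x: "x \<in> coord_space n" for x
  proof -
    have step: "f x = f (r l x) + (\<Sum>i<l. x i * ?h i x)" if "l \<le> n" for l
      using that
    proof (induction l)
      case (Suc l)
      have "(r l x)(l := 0) = r (Suc l) x" "r l x l = x l"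
        by (auto simp: r_def fun_eq_iff less_Suc_eq)
      then show ?case
        using Suc slice_hadamard[OF smooth_Ck[OF f] r[OF x], of l l] by simp
    qed (simp add: r_def)
    have "r n x = (\<lambda>_. 0)"
      using x by (auto simp: r_def coord_space_def)
    then show ?thesis using step[of n] by simp
  qed
qed

section \<open>Euclidean space as a manifold\<close>

definition coord_manifold :: "nat \<Rightarrow> (nat \<Rightarrow> real) manifold" where
  "coord_manifold n = \<lparr>mtop = Euclidean_space n, mdim = n, matlas = {(coord_space n, id)}\<rparr>"

lemma coord_manifold_simps [simp]:
  "mtop (coord_manifold n) = top_of_set (coord_space n)"
  "mdim (coord_manifold n) = n"
  "matlas (coord_manifold n) = {(coord_space n, id)}"
  by (simp_all add: coord_manifold_def Euclidean_space_eq)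

lemma second_countable_euclidean:
  "second_countable (euclidean :: 'a::second_countable_topology topology)"
proof -
  obtain B :: "'a set set" where "countable B" "topological_basis B"
    using ex_countable_basis by blast
  moreover from this have "\<exists>V\<in>B. x \<in> V \<and> V \<subseteq> U" if "open U" "x \<in> U" for U x
    using that by (meson topological_basisE)
  ultimately show ?thesis
    unfolding second_countable_def
    by (intro exI[of _ B]) (simp add: topological_basis_open)
qed

lemma inv_into_id: "x \<in> S \<Longrightarrow> inv_into S id x = x"
  using inv_into_f_f[of id S x] by simp

lemma smooth_manifold_coord: "smooth_manifold (coord_manifold n)"
proof -
  have "Hausdorff_space (top_of_set (coord_space n))"
    using Hausdorff_Euclidean_space[of n] by (simp add: Euclidean_space_eq)
  moreover have "second_countable (top_of_set (coord_space n))"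
    by (intro second_countable_subtopology second_countable_euclidean)
  moreover have "smooth n (\<lambda>x. inv_into (coord_space n) id x j)" for j
    using smooth_cong[of n "\<lambda>x. inv_into (coord_space n) id x j" "\<lambda>x. x j"]
    by (simp add: inv_into_id)
  ultimately show ?thesis
    by (simp add: smooth_manifold_def Euclidean_space_eq)
qed

lemma smooth_funs_coord:
  "smooth_funs (coord_manifold n) = {f. smooth n f \<and> (\<forall>p. p \<notin> coord_space n \<longrightarrow> f p = 0)}"
proof -
  have "smooth n (\<lambda>x. f (inv_into (coord_space n) id x)) = smooth n f" for f
    by (rule smooth_cong) (simp add: inv_into_id)
  then have "smooth_map (coord_manifold n) real_manifold f \<longleftrightarrow> smooth n f" for f
    by (auto simp: smooth_map_def real_manifold_def smooth_continuous)
  then show ?thesis by (simp add: smooth_funs_def)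
qed

lemma simply_connected_coord: "simply_connected_space (mtop (coord_manifold n))"
  unfolding simply_connected_space_def
proof (intro conjI allI impI)
  have seg: "(\<lambda>i. (1 - s) * x i + s * y i) \<in> coord_space n"
    if "x \<in> coord_space n" "y \<in> coord_space n" for x y and s :: real
    using that by (simp add: coord_space_def)
  show "path_connected_space (mtop (coord_manifold n))"
    unfolding path_connected_space_def
  proof (intro ballI)
    fix x y assume "x \<in> topspace (mtop (coord_manifold n))" "y \<in> topspace (mtop (coord_manifold n))"
    then have xy: "x \<in> coord_space n" "y \<in> coord_space n" by auto
    let ?g = "\<lambda>s::real. \<lambda>i. (1 - s) * x i + s * y i"
    have "continuous_on {0..1} ?g"
      by (intro continuous_on_coordinatewise_then_product continuous_on_add continuous_on_mult
          continuous_on_diff continuous_on_const continuous_on_id)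
    then have "pathin (mtop (coord_manifold n)) ?g"
      using seg[OF xy] by (auto simp: pathin_def)
    then show "\<exists>g. pathin (mtop (coord_manifold n)) g \<and> g 0 = x \<and> g 1 = y"
      by (intro exI[of _ ?g]) auto
  qed
  fix p assume p: "pathin (mtop (coord_manifold n)) p \<and> p 1 = p 0"
  then have cont: "continuous_on {0..1} p" and pin: "\<And>t. t \<in> {0..1} \<Longrightarrow> p t \<in> coord_space n"
    by (auto simp: pathin_def)
  \<comment> \<open>Contraction of the loop to its base point along straight segments;
    \<open>p 1 = p 0\<close> keeps both ends fixed.\<close>
  let ?h = "\<lambda>z::real \<times> real. \<lambda>i. (1 - fst z) * p (snd z) i + fst z * p 0 i"
  have ci: "continuous_on {0..1} (\<lambda>t. p t i)" for i
    by (rule continuous_on_product_then_coordinatewise[OF cont])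
  have "continuous_on ({0..1} \<times> {0..1}) (\<lambda>z. p (snd z) i)" for i
    by (rule continuous_on_compose2[OF ci continuous_on_snd[OF continuous_on_id]]) auto
  then have "continuous_on ({0..1} \<times> {0..1}) ?h"
    by (intro continuous_on_coordinatewise_then_product continuous_on_add continuous_on_mult
          continuous_on_diff continuous_on_const continuous_on_id continuous_on_fst)
  then have "continuous_map (prod_topology (top_of_set {0..1}) (top_of_set {0..1}))
     (mtop (coord_manifold n)) ?h"
    using seg pin by (auto simp: image_subset_iff)
  then show "homotopic_with (\<lambda>h. h 0 = p 0 \<and> h 1 = p 0) (top_of_set {0..1}) (mtop (coord_manifold n)) p (\<lambda>_. p 0)"
    unfolding homotopic_with_def
    using p by (intro exI[of _ ?h]) (auto simp: algebra_simps fun_eq_iff)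
qed

text \<open>The chart of the product manifold in curried form; \<open>lower_coords\<close> and
  \<open>upper_coords\<close> are the two components of its inverse. Their cut-off at
  \<open>n\<close> puts every value into \<open>coord_space n\<close>.\<close>

definition join_coords :: "nat \<Rightarrow> (nat \<Rightarrow> real) \<Rightarrow> (nat \<Rightarrow> real) \<Rightarrow> nat \<Rightarrow> real" where
  "join_coords n p q = (\<lambda>i. if i < n then p i else q (i - n))"

definition lower_coords :: "nat \<Rightarrow> (nat \<Rightarrow> real) \<Rightarrow> nat \<Rightarrow> real" where
  "lower_coords n z = (\<lambda>i. if i < n then z i else 0)"

definition upper_coords :: "nat \<Rightarrow> (nat \<Rightarrow> real) \<Rightarrow> nat \<Rightarrow> real" where
  "upper_coords n z = (\<lambda>i. if i < n then z (n + i) else 0)"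

lemma lower_upper_in [simp]:
  "lower_coords n z \<in> coord_space n" "upper_coords n z \<in> coord_space n"
  by (auto simp: lower_coords_def upper_coords_def coord_space_def)

lemma join_in [simp]:
  "p \<in> coord_space n \<Longrightarrow> q \<in> coord_space n \<Longrightarrow> join_coords n p q \<in> coord_space (n + n)"
  by (auto simp: join_coords_def coord_space_def)

lemma lower_join [simp]: "p \<in> coord_space n \<Longrightarrow> lower_coords n (join_coords n p q) = p"
  by (auto simp: join_coords_def lower_coords_def coord_space_def)

lemma upper_join [simp]: "q \<in> coord_space n \<Longrightarrow> upper_coords n (join_coords n p q) = q"
  by (auto simp: join_coords_def upper_coords_def coord_space_def)

lemma join_lower_upper [simp]:
  "z \<in> coord_space (n + n) \<Longrightarrow> join_coords n (lower_coords n z) (upper_coords n z) = z"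
  by (auto simp: join_coords_def lower_coords_def upper_coords_def coord_space_def)

lemma smooth_map_coord:
  assumes "\<And>x. x \<in> coord_space n \<Longrightarrow> f x \<in> coord_space m"
    and "\<And>j. j < m \<Longrightarrow> smooth n (\<lambda>x. f x j)"
  shows "smooth_map (coord_manifold n) (coord_manifold m) f"
proof -
  have "continuous_on (coord_space n) (\<lambda>x. f x j)" for j
  proof (cases "j < m")
    case False
    then have "f x j = 0" if "x \<in> coord_space n" for x
      using assms(1)[OF that] by (simp add: coord_space_def)
    then show ?thesis
      using continuous_on_cong[of "coord_space n" "coord_space n" "\<lambda>x. f x j" "\<lambda>_. 0"] by simp
  qed (use assms smooth_continuous in blast)
  then have "continuous_on (coord_space n) f"
    by (rule continuous_on_coordinatewise_then_product)
  moreover have "coord_space n \<inter> f -` coord_space m = coord_space n"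
    using assms(1) by auto
  moreover have "smooth n (\<lambda>x. f (inv_into (coord_space n) id x) j)" if "j < m" for j
    using smooth_cong[of n "\<lambda>x. f (inv_into (coord_space n) id x) j" "\<lambda>x. f x j"]
      assms(2)[OF that] by (simp add: inv_into_id)
  ultimately show ?thesis
    using assms(1) by (auto simp: smooth_map_def)
qed

lemma smooth_map_coord2:
  assumes "\<And>x y. x \<in> coord_space n \<Longrightarrow> y \<in> coord_space n \<Longrightarrow> f x y \<in> coord_space n"
    and "\<And>j. j < n \<Longrightarrow> smooth (n + n) (\<lambda>z. f (lower_coords n z) (upper_coords n z) j)"
  shows "smooth_map (prod_manifold (coord_manifold n) (coord_manifold n)) (coord_manifold n)
           (\<lambda>(x, y). f x y)"
proof -
  let ?E = "coord_space n" and ?J = "\<lambda>(p, q). join_coords n p q"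
  have atlas: "matlas (prod_manifold (coord_manifold n) (coord_manifold n)) = {(?E \<times> ?E, ?J)}"
    unfolding prod_manifold_def join_coords_def coord_manifold_simps id_def by simp
  have img: "?J ` (?E \<times> ?E) = coord_space (n + n)"
  proof safe
    fix z assume "z \<in> coord_space (n + n)"
    then show "z \<in> ?J ` (?E \<times> ?E)"
      by (intro image_eqI[of _ _ "(lower_coords n z, upper_coords n z)"]) auto
  qed auto
  have inj: "inj_on ?J (?E \<times> ?E)"
    by (intro inj_on_inverseI[of _ "\<lambda>z. (lower_coords n z, upper_coords n z)"]) auto
  have inv: "inv_into (?E \<times> ?E) ?J z = (lower_coords n z, upper_coords n z)"
    if "z \<in> coord_space (n + n)" for z
    using that inj by (intro inv_into_f_eq) auto
  have "smooth (n + n) (\<lambda>z. (\<lambda>(x, y). f x y) (inv_into (?E \<times> ?E) ?J z) j)" if "j < n" for j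
    using smooth_cong[of "n + n" "\<lambda>z. (\<lambda>(x, y). f x y) (inv_into (?E \<times> ?E) ?J z) j"
        "\<lambda>z. f (lower_coords n z) (upper_coords n z) j"] assms(2)[OF that]
    by (simp add: inv)
  moreover have "(?E \<times> ?E) \<inter> (\<lambda>(x, y). f x y) -` ?E = ?E \<times> ?E"
    using assms(1) by auto
  \<comment> \<open>Continuity on the product comes from the smooth form on
    \<open>coord_space (n + n)\<close>, pulled back along the continuous map that joins two
    points.\<close>
  moreover have "continuous_on (?E \<times> ?E) (\<lambda>z. f (fst z) (snd z) j)" for j
  proof (cases "j < n")
    case True
    have "continuous_on (?E \<times> ?E) (\<lambda>z. join_coords n (fst z) (snd z) i)" for i
      unfolding join_coords_def
      by (cases "i < n")
        (simp_all add: continuous_on_product_then_coordinatewise[OF continuous_on_fst[OF continuous_on_id]]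
          continuous_on_product_then_coordinatewise[OF continuous_on_snd[OF continuous_on_id]])
    then have "continuous_on (?E \<times> ?E) (\<lambda>z. join_coords n (fst z) (snd z))"
      by (rule continuous_on_coordinatewise_then_product)
    then have "continuous_on (?E \<times> ?E) (\<lambda>z. f (lower_coords n (join_coords n (fst z) (snd z)))
        (upper_coords n (join_coords n (fst z) (snd z))) j)"
      by (rule continuous_on_compose2[OF smooth_continuous[OF assms(2)[OF True]]]) auto
    then show ?thesis
      by (rule continuous_on_eq) auto
  next
    case False
    then have "f (fst z) (snd z) j = 0" if "z \<in> ?E \<times> ?E" for z
      using assms(1)[of "fst z" "snd z"] that by (auto simp: coord_space_def)
    then show ?thesis
      using continuous_on_cong[of "?E \<times> ?E" "?E \<times> ?E" "\<lambda>z. f (fst z) (snd z) j" "\<lambda>_. 0"] by simp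
  qed
  then have "continuous_on (?E \<times> ?E) (\<lambda>z. f (fst z) (snd z))"
    by (rule continuous_on_coordinatewise_then_product)
  then have "continuous_map (mtop (prod_manifold (coord_manifold n) (coord_manifold n)))
      (mtop (coord_manifold n)) (\<lambda>(x, y). f x y)"
    using assms(1) by (auto simp: prod_manifold_def split_beta image_subset_iff)
  moreover have "mdim (prod_manifold (coord_manifold n) (coord_manifold n)) = n + n"
    by (simp add: prod_manifold_def)
  ultimately show ?thesis
    unfolding smooth_map_def atlas by (simp add: img)
qed

section \<open>Lie groups with a global chart\<close>

lemma partial_cong:
  assumes "\<And>x. x \<in> coord_space n \<Longrightarrow> f x = g x" "x \<in> coord_space n" "i < n"
  shows "partial i f x = partial i g x"
  using assms by (simp add: partial_def)

lemma partial_add: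
  assumes "smooth n f" "smooth n g" "x \<in> coord_space n" "i < n"
  shows "partial i (\<lambda>x. f x + g x) x = partial i f x + partial i g x"
  by (rule partial_eqI)
    (rule DERIV_add[OF has_partial_at[OF smooth_Ck[OF assms(1)] assms(3,4)]
        has_partial_at[OF smooth_Ck[OF assms(2)] assms(3,4)]])

lemma partial_mult:
  assumes "smooth n f" "smooth n g" "x \<in> coord_space n" "i < n"
  shows "partial i (\<lambda>x. f x * g x) x = f x * partial i g x + g x * partial i f x"
  by (rule partial_eqI)
    (use DERIV_mult[OF has_partial_at[OF smooth_Ck[OF assms(1)] assms(3,4)]
        has_partial_at[OF smooth_Ck[OF assms(2)] assms(3,4)]] in \<open>simp only: fun_upd_triv mult.commute add.commute\<close>)

lemma partial_const [simp]: "partial i (\<lambda>x. c) x = 0"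
  by (simp add: partial_def)

lemma partial_coord [simp]: "partial i (\<lambda>x. x j) x = (if i = j then 1 else 0)"
  by (simp add: partial_def)

lemma smooth_join:
  assumes "\<And>i. i < n \<Longrightarrow> smooth m (\<lambda>x. f x i)" "\<And>i. i < n \<Longrightarrow> smooth m (\<lambda>x. g x i)" "j < n + n"
  shows "smooth m (\<lambda>x. join_coords n (f x) (g x) j)"
  using assms by (cases "j < n") (auto simp: join_coords_def)

text \<open>Members of \<open>smooth_funs\<close> vanish off the manifold, so a coordinate becomes a
  member only after this cut-off.\<close>

definition coord_fun :: "nat \<Rightarrow> nat \<Rightarrow> (nat \<Rightarrow> real) \<Rightarrow> real" where
  "coord_fun n i p = (if p \<in> coord_space n then p i else 0)"

lemma coord_fun_in: "coord_fun n i \<in> smooth_funs (coord_manifold n)"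
  using smooth_cong[of n "coord_fun n i" "\<lambda>x. x i"] by (simp add: smooth_funs_coord coord_fun_def)

section \<open>Derivations of the algebra of smooth functions\<close>

lemma smooth_funs_add:
  "f \<in> smooth_funs (coord_manifold n) \<Longrightarrow> g \<in> smooth_funs (coord_manifold n) \<Longrightarrow>
     (\<lambda>p. f p + g p) \<in> smooth_funs (coord_manifold n)"
  by (simp add: smooth_funs_coord smooth_add)

lemma smooth_funs_mult:
  "f \<in> smooth_funs (coord_manifold n) \<Longrightarrow> g \<in> smooth_funs (coord_manifold n) \<Longrightarrow>
     (\<lambda>p. f p * g p) \<in> smooth_funs (coord_manifold n)"
  by (simp add: smooth_funs_coord smooth_mult)

lemma smooth_funs_scale:
  "f \<in> smooth_funs (coord_manifold n) \<Longrightarrow> (\<lambda>p. c * f p) \<in> smooth_funs (coord_manifold n)"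
  by (simp add: smooth_funs_coord smooth_mult)

lemma smooth_funs_sum:
  "(\<And>i. i \<in> I \<Longrightarrow> f i \<in> smooth_funs (coord_manifold n)) \<Longrightarrow>
     (\<lambda>p. \<Sum>i\<in>I. f i p) \<in> smooth_funs (coord_manifold n)"
  by (simp add: smooth_funs_coord smooth_sum)

lemma smooth_funs_zero: "(\<lambda>p. 0) \<in> smooth_funs (coord_manifold n)"
  by (simp add: smooth_funs_coord)

context
  fixes n X
  assumes X: "vector_field (coord_manifold n) X"
begin

lemma vector_field_in: "f \<in> smooth_funs (coord_manifold n) \<Longrightarrow> X f \<in> smooth_funs (coord_manifold n)"
  using X by (simp add: vector_field_def)

lemma vector_field_undef: "f \<notin> smooth_funs (coord_manifold n) \<Longrightarrow> X f = (\<lambda>p. 0)"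
  using X by (simp add: vector_field_def)

lemma vector_field_add:
  "f \<in> smooth_funs (coord_manifold n) \<Longrightarrow> g \<in> smooth_funs (coord_manifold n) \<Longrightarrow>
     X (\<lambda>p. f p + g p) = (\<lambda>p. X f p + X g p)"
  using X by (simp add: vector_field_def fun_eq_iff)

lemma vector_field_scale:
  "f \<in> smooth_funs (coord_manifold n) \<Longrightarrow> X (\<lambda>p. c * f p) = (\<lambda>p. c * X f p)"
  using X by (simp add: vector_field_def fun_eq_iff)

lemma vector_field_mult:
  "f \<in> smooth_funs (coord_manifold n) \<Longrightarrow> g \<in> smooth_funs (coord_manifold n) \<Longrightarrow>
     X (\<lambda>p. f p * g p) = (\<lambda>p. f p * X g p + g p * X f p)"
  using X by (simp add: vector_field_def fun_eq_iff)

lemma vector_field_zero: "X (\<lambda>p. 0) = (\<lambda>p. 0)"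
  using vector_field_scale[of "\<lambda>p. 0" 0] by (simp add: smooth_funs_zero)

lemma vector_field_sum:
  "(\<And>i. i \<in> I \<Longrightarrow> f i \<in> smooth_funs (coord_manifold n)) \<Longrightarrow>
     X (\<lambda>p. \<Sum>i\<in>I. f i p) = (\<lambda>p. \<Sum>i\<in>I. X (f i) p)"
proof (induction I rule: infinite_finite_induct)
  case (insert i I)
  then show ?case
    using vector_field_add[of "f i" "\<lambda>p. \<Sum>i\<in>I. f i p"] smooth_funs_sum[of I f] by simp
qed (simp_all add: vector_field_zero)

text \<open>Applied to Hadamard's expansion, the derivation kills the constant. By the Leibniz rule
  each product leaves only the term in which the coordinate is differentiated, since coordinates
  vanish at the origin.\<close>

lemma vector_field_at_zero:
  assumes f: "f \<in> smooth_funs (coord_manifold n)"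
  shows "X f (\<lambda>_. 0) = (\<Sum>i<n. X (coord_fun n i) (\<lambda>_. 0) * partial i f (\<lambda>_. 0))"
proof -
  have "smooth n f" and f0: "\<And>p. p \<notin> coord_space n \<Longrightarrow> f p = 0"
    using f by (auto simp: smooth_funs_coord)
  then obtain h where h: "\<And>i. i < n \<Longrightarrow> smooth n (h i)"
    "\<And>i. i < n \<Longrightarrow> h i (\<lambda>_. 0) = partial i f (\<lambda>_. 0)"
    "\<And>x. x \<in> coord_space n \<Longrightarrow> f x = f (\<lambda>_. 0) + (\<Sum>i<n. x i * h i x)"
    using hadamard by blast
  \<comment> \<open>The unit of \<open>smooth_funs\<close>. As it is idempotent, the Leibniz rule at
    the origin gives \<open>X e\<close> = 2 \<open>X e\<close> there, so constants have derivative
    0.\<close>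
  define e :: "(nat \<Rightarrow> real) \<Rightarrow> real" where "e p = (if p \<in> coord_space n then 1 else 0)" for p
  define k where "k i p = (if p \<in> coord_space n then h i p else 0)" for i p
  have e: "e \<in> smooth_funs (coord_manifold n)"
    using smooth_cong[of n e "\<lambda>_. 1"] by (simp add: smooth_funs_coord e_def)
  have k: "k i \<in> smooth_funs (coord_manifold n)" if "i < n" for i
    using smooth_cong[of n "k i" "h i"] h(1)[OF that] by (simp add: smooth_funs_coord k_def)
  have ee: "(\<lambda>p. e p * e p) = e"
    by (auto simp: e_def fun_eq_iff)
  have "X e (\<lambda>_. 0) = 0"
    using fun_cong[OF vector_field_mult[OF e e], of "\<lambda>_. 0"] unfolding ee by (simp add: e_def)
  have feq: "f = (\<lambda>p. f (\<lambda>_. 0) * e p + (\<Sum>i<n. coord_fun n i p * k i p))"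
  proof
    fix p
    show "f p = f (\<lambda>_. 0) * e p + (\<Sum>i<n. coord_fun n i p * k i p)"
    proof (cases "p \<in> coord_space n")
      case True
      then show ?thesis using h(3)[OF True] by (simp add: e_def k_def coord_fun_def)
    next
      case False
      then show ?thesis using f0 by (simp add: e_def k_def coord_fun_def)
    qed
  qed
  have ck: "(\<lambda>p. coord_fun n i p * k i p) \<in> smooth_funs (coord_manifold n)" if "i \<in> {..<n}" for i
    using smooth_funs_mult[OF coord_fun_in k] that by blast
  have "X (\<lambda>p. f (\<lambda>_. 0) * e p + (\<Sum>i<n. coord_fun n i p * k i p)) (\<lambda>_. 0) =
      f (\<lambda>_. 0) * X e (\<lambda>_. 0) + (\<Sum>i<n. X (\<lambda>p. coord_fun n i p * k i p) (\<lambda>_. 0))"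
    by (simp only: vector_field_add[OF smooth_funs_scale[OF e] smooth_funs_sum[OF ck]]
        vector_field_scale[OF e] vector_field_sum[OF ck])
  also have "\<dots> = (\<Sum>i<n. X (\<lambda>p. coord_fun n i p * k i p) (\<lambda>_. 0))"
    using \<open>X e _ = 0\<close> by simp
  also have "\<dots> = (\<Sum>i<n. X (coord_fun n i) (\<lambda>_. 0) * partial i f (\<lambda>_. 0))"
  proof (rule sum.cong)
    fix i assume "i \<in> {..<n}"
    then have "coord_fun n i (\<lambda>_. 0) = 0" "k i (\<lambda>_. 0) = partial i f (\<lambda>_. 0)"
      "X (\<lambda>p. coord_fun n i p * k i p) =
        (\<lambda>p. coord_fun n i p * X (k i) p + k i p * X (coord_fun n i) p)"
      using h(2) vector_field_mult[OF coord_fun_in k] by (auto simp: coord_fun_def k_def)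
    then show "X (\<lambda>p. coord_fun n i p * k i p) (\<lambda>_. 0) =
        X (coord_fun n i) (\<lambda>_. 0) * partial i f (\<lambda>_. 0)"
      by simp
  qed simp
  finally show ?thesis using feq by simp
qed

end

lemma lie_bracket_vector_field:
  assumes X: "vector_field (coord_manifold n) X" and Y: "vector_field (coord_manifold n) Y"
  shows "vector_field (coord_manifold n) (lie_bracket X Y)"
  unfolding vector_field_def
proof (intro conjI ballI allI impI)
  fix f assume f: "f \<in> smooth_funs (coord_manifold n)"
  note XY = vector_field_in[OF X] vector_field_in[OF Y]
  have "(\<lambda>p. X (Y f) p + - 1 * Y (X f) p) \<in> smooth_funs (coord_manifold n)"
    by (intro smooth_funs_add smooth_funs_scale XY f)
  then show "lie_bracket X Y f \<in> smooth_funs (coord_manifold n)"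
    by (simp add: lie_bracket_def)
  show "lie_bracket X Y (\<lambda>p. c * f p) p = c * lie_bracket X Y f p" for c p
    by (simp add: lie_bracket_def vector_field_scale[OF X] vector_field_scale[OF Y] f XY algebra_simps)
  fix g assume g: "g \<in> smooth_funs (coord_manifold n)"
  show "lie_bracket X Y (\<lambda>p. f p + g p) p = lie_bracket X Y f p + lie_bracket X Y g p" for p
    by (simp add: lie_bracket_def vector_field_add[OF X] vector_field_add[OF Y] f g XY)
  show "lie_bracket X Y (\<lambda>p. f p * g p) p = f p * lie_bracket X Y g p + g p * lie_bracket X Y f p" for p
    by (simp add: lie_bracket_def vector_field_add[OF X] vector_field_add[OF Y]
        vector_field_mult[OF X] vector_field_mult[OF Y] f g XY smooth_funs_mult algebra_simps)
next
  fix f assume "f \<notin> smooth_funs (coord_manifold n)"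
  then show "lie_bracket X Y f = (\<lambda>p. 0)"
    by (simp add: lie_bracket_def vector_field_undef[OF X] vector_field_undef[OF Y]
        vector_field_zero[OF X] vector_field_zero[OF Y])
qed

text \<open>A Lie group with one global chart. Placing the identity at the origin turns evaluation
  at the identity into the situation of \<open>vector_field_at_zero\<close>.\<close>

locale coord_lie_group = group G for G :: "(nat \<Rightarrow> real) monoid" (structure) +
  fixes n :: nat
  assumes carrier_eq: "carrier G = coord_space n"
    and one_eq: "\<one> = (\<lambda>_. 0)"
    and mult_smooth: "j < n \<Longrightarrow> smooth (n + n) (\<lambda>z. (lower_coords n z \<otimes> upper_coords n z) j)"
    and inv_smooth: "j < n \<Longrightarrow> smooth n (\<lambda>x. (inv x) j)"
begin

abbreviation "M \<equiv> coord_manifold n"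

lemma lie_group: "lie_group G M"
proof -
  have "smooth_map (prod_manifold M M) M (\<lambda>(x, y). x \<otimes> y)"
    by (rule smooth_map_coord2) (use m_closed carrier_eq mult_smooth in auto)
  moreover have "smooth_map M M (\<lambda>x. inv x)"
    by (rule smooth_map_coord) (use inv_closed carrier_eq inv_smooth in auto)
  ultimately show ?thesis
    using smooth_manifold_coord is_group by (simp add: lie_group_def carrier_eq)
qed

lemma mult_in: "p \<in> coord_space n \<Longrightarrow> q \<in> coord_space n \<Longrightarrow> p \<otimes> q \<in> coord_space n"
  using m_closed carrier_eq by simp

lemma mult_zero [simp]: "p \<in> coord_space n \<Longrightarrow> p \<otimes> (\<lambda>_. 0) = p"
  using r_one unfolding one_eq carrier_eq .

lemma zero_mult [simp]: "p \<in> coord_space n \<Longrightarrow> (\<lambda>_. 0) \<otimes> p = p"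
  using l_one unfolding one_eq carrier_eq .

lemma smooth_translate: "p \<in> coord_space n \<Longrightarrow> j < n \<Longrightarrow> smooth n (\<lambda>q. (p \<otimes> q) j)"
proof -
  assume p: "p \<in> coord_space n" and j: "j < n"
  have "smooth n (\<lambda>q. (lower_coords n (join_coords n p q) \<otimes> upper_coords n (join_coords n p q)) j)"
    by (rule smooth_compose[OF mult_smooth[OF j]]) (use p in \<open>auto intro: smooth_join\<close>)
  then show ?thesis
    using smooth_cong[of n "\<lambda>q. (lower_coords n (join_coords n p q) \<otimes> upper_coords n (join_coords n p q)) j"
        "\<lambda>q. (p \<otimes> q) j"] p by simp
qed

section \<open>Left-invariant vector fields\<close>

lemma left_translate_in:
  assumes "p \<in> coord_space n" "f \<in> smooth_funs M"
  shows "left_translate G p f \<in> smooth_funs M"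
proof -
  have "smooth n (\<lambda>q. f (p \<otimes> q))"
    by (rule smooth_compose[of n f]) (use assms in \<open>auto simp: smooth_funs_coord mult_in smooth_translate\<close>)
  then show ?thesis
    using smooth_cong[of n "left_translate G p f" "\<lambda>q. f (p \<otimes> q)"]
    by (simp add: smooth_funs_coord left_translate_def carrier_eq)
qed

lemma left_translate_assoc:
  assumes "a \<in> coord_space n" "p \<in> coord_space n"
  shows "left_translate G p (left_translate G a f) = left_translate G (a \<otimes> p) f"
  using assms by (auto simp: left_translate_def fun_eq_iff m_assoc carrier_eq mult_in)

lemma left_translate_zero: "f \<in> smooth_funs M \<Longrightarrow> left_translate G (\<lambda>_. 0) f = f"
  by (auto simp: left_translate_def fun_eq_iff smooth_funs_coord carrier_eq)

text \<open>The left-invariant field with tangent vector \<open>v\<close> at the identity: at p it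
  differentiates along the left translate of \<open>v\<close>. Only entries of \<open>v\<close>
  below \<open>n\<close> enter.\<close>

definition left_field :: "(nat \<Rightarrow> real) \<Rightarrow> (nat \<Rightarrow> real) oper" where
  "left_field v = (\<lambda>f p. if f \<in> smooth_funs M \<and> p \<in> coord_space n
     then \<Sum>i<n. v i * partial i (left_translate G p f) (\<lambda>_. 0) else 0)"

lemma partial_left_translate:
  assumes f: "smooth n f" and p: "p \<in> coord_space n" and i: "i < n"
  shows "partial i (left_translate G p f) (\<lambda>_. 0) =
    (\<Sum>j<n. partial j f p * partial i (\<lambda>q. (p \<otimes> q) j) (\<lambda>_. 0))"
proof -
  have "partial i (left_translate G p f) (\<lambda>_. 0) = partial i (\<lambda>q. f (p \<otimes> q)) (\<lambda>_. 0)"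
    by (rule partial_cong[OF _ _ i]) (simp_all add: left_translate_def carrier_eq)
  also have "\<dots> = (\<Sum>j<n. partial j f (p \<otimes> (\<lambda>_. 0)) * partial i (\<lambda>q. (p \<otimes> q) j) (\<lambda>_. 0))"
    by (rule partial_compose[OF smooth_Ck[OF f] _ smooth_Ck[OF smooth_translate] _ i])
      (use p in \<open>simp_all add: mult_in\<close>)
  also have "p \<otimes> (\<lambda>_. 0) = p"
    using p by simp
  finally show ?thesis .
qed

lemma left_field_smooth:
  assumes f: "f \<in> smooth_funs M"
  shows "left_field v f \<in> smooth_funs M"
proof -
  let ?m = "\<lambda>j z. (lower_coords n z \<otimes> upper_coords n z) j"
  \<comment> \<open>The derivative of translation by p in direction i is a partial derivative of the
    product in the joined variables, taken in variable n + i at second argument 0. In this form it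
    is smooth in p.\<close>
  have eq: "partial i (\<lambda>q. (p \<otimes> q) j) (\<lambda>_. 0) = partial (n + i) (?m j) (join_coords n p (\<lambda>_. 0))"
    if "i < n" "p \<in> coord_space n" for i j p
  proof -
    have "(join_coords n p (\<lambda>_. 0))(n + i := t) = join_coords n p ((\<lambda>_. 0)(i := t))" for t
      by (auto simp: join_coords_def fun_eq_iff)
    moreover have "join_coords n p (\<lambda>_. 0) (n + i) = 0"
      by (simp add: join_coords_def)
    ultimately show ?thesis
      using that by (simp add: partial_def)
  qed
  have "smooth n (\<lambda>p. \<Sum>i<n. v i * (\<Sum>j<n. partial j f p *
          partial (n + i) (?m j) (join_coords n p (\<lambda>_. 0))))"
  proof (intro smooth_sum smooth_mult smooth_const)
    fix i j assume ij: "i \<in> {..<n}" "j \<in> {..<n}"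
    then show "smooth n (partial j f)"
      using f by (simp add: smooth_funs_coord smooth_partial)
    show "smooth n (\<lambda>p. partial (n + i) (?m j) (join_coords n p (\<lambda>_. 0)))"
      by (rule smooth_compose[OF smooth_partial[OF mult_smooth]]) (use ij in \<open>auto intro: smooth_join\<close>)
  qed
  moreover have "left_field v f p = (\<Sum>i<n. v i * (\<Sum>j<n. partial j f p *
          partial (n + i) (?m j) (join_coords n p (\<lambda>_. 0))))" if "p \<in> coord_space n" for p
    using f that by (simp add: left_field_def partial_left_translate smooth_funs_coord eq)
  ultimately show ?thesis
    using smooth_cong[of n "left_field v f"] by (auto simp: smooth_funs_coord left_field_def)
qed

lemma left_field_in: "left_field v \<in> lie_algebra G M"
proof -
  let ?o = "\<lambda>_. 0 :: real"
  have S: "smooth n (left_translate G p f)" if "p \<in> coord_space n" "f \<in> smooth_funs M" for p f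
    using left_translate_in[OF that] by (simp add: smooth_funs_coord)
  have "vector_field M (left_field v)"
    unfolding vector_field_def
  proof (intro conjI ballI allI impI)
    fix f assume f: "f \<in> smooth_funs M"
    show "left_field v f \<in> smooth_funs M" by (rule left_field_smooth[OF f])
    show "left_field v (\<lambda>p. c * f p) p = c * left_field v f p" for c p
    proof (cases "p \<in> coord_space n")
      case p: True
      have lt: "left_translate G p (\<lambda>p. c * f p) = (\<lambda>q. c * left_translate G p f q)"
        by (auto simp: left_translate_def)
      have "partial i (\<lambda>q. c * left_translate G p f q) ?o = c * partial i (left_translate G p f) ?o"
        if "i < n" for i
        using partial_mult[OF smooth_const[of n c] S[OF p f] _ that] by simp
      then show ?thesis
        using p f by (simp add: left_field_def smooth_funs_scale lt sum_distrib_left algebra_simps)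
    qed (simp add: left_field_def)
    fix g assume g: "g \<in> smooth_funs M"
    show "left_field v (\<lambda>p. f p + g p) p = left_field v f p + left_field v g p" for p
    proof (cases "p \<in> coord_space n")
      case p: True
      have lt: "left_translate G p (\<lambda>p. f p + g p) = (\<lambda>q. left_translate G p f q + left_translate G p g q)"
        by (auto simp: left_translate_def)
      show ?thesis
        using p f g by (simp add: left_field_def smooth_funs_add lt sum.distrib[symmetric]
            partial_add[OF S[OF p f] S[OF p g]] algebra_simps)
    qed (simp add: left_field_def)
    show "left_field v (\<lambda>p. f p * g p) p = f p * left_field v g p + g p * left_field v f p" for p
    proof (cases "p \<in> coord_space n")
      case p: True
      have lt: "left_translate G p (\<lambda>p. f p * g p) = (\<lambda>q. left_translate G p f q * left_translate G p g q)"
        by (auto simp: left_translate_def)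
      have "left_translate G p h ?o = h p" for h
        using p by (simp add: left_translate_def carrier_eq)
      then show ?thesis
        using p f g by (simp add: left_field_def smooth_funs_mult lt sum_distrib_left sum.distrib[symmetric]
            partial_mult[OF S[OF p f] S[OF p g]] algebra_simps)
    qed (simp add: left_field_def)
  next
    fix f assume "f \<notin> smooth_funs M"
    then show "left_field v f = (\<lambda>p. 0)" by (simp add: left_field_def)
  qed
  moreover have "left_field v (left_translate G a f) = left_translate G a (left_field v f)"
    if "a \<in> carrier G" "f \<in> smooth_funs M" for a f
  proof
    fix p
    have "left_translate G p (left_translate G a f) = left_translate G (a \<otimes> p) f"
      if "p \<in> coord_space n"
      using that \<open>a \<in> carrier G\<close> by (simp add: left_translate_assoc carrier_eq)
    then show "left_field v (left_translate G a f) p = left_translate G a (left_field v f) p"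
      using that left_translate_in
      by (simp add: left_field_def left_translate_def[of G a "\<lambda>p. if _ p then _ p else 0"]
          carrier_eq mult_in)
  qed
  ultimately show ?thesis
    by (simp add: lie_algebra_def)
qed

text \<open>Left invariance carries evaluation at p to evaluation at the identity, where the values
  on coordinate functions determine the derivation. All other arguments are settled by the
  normalisations to 0.\<close>

lemma lie_algebra_eq_left_field:
  assumes X: "X \<in> lie_algebra G M"
  shows "X = left_field (\<lambda>i. X (coord_fun n i) (\<lambda>_. 0))"
proof (intro ext)
  fix f p
  have V: "vector_field M X" and L: "\<And>a f. a \<in> coord_space n \<Longrightarrow> f \<in> smooth_funs M \<Longrightarrow>
      X (left_translate G a f) = left_translate G a (X f)"
    using X by (auto simp: lie_algebra_def carrier_eq)
  consider "f \<notin> smooth_funs M" | "f \<in> smooth_funs M" "p \<notin> coord_space n"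
    | "f \<in> smooth_funs M" "p \<in> coord_space n" by blast
  then show "X f p = left_field (\<lambda>i. X (coord_fun n i) (\<lambda>_. 0)) f p"
  proof cases
    case 1
    then show ?thesis by (simp add: left_field_def vector_field_undef[OF V])
  next
    case 2
    then show ?thesis
      using vector_field_in[OF V] by (simp add: left_field_def smooth_funs_coord)
  next
    case 3
    have "X (left_translate G p f) (\<lambda>_. 0) = X f p"
      using 3 fun_cong[OF L[OF 3(2,1)], of "\<lambda>_. 0"]
      by (simp add: left_translate_def[of G p "X f"] carrier_eq)
    then show ?thesis
      using vector_field_at_zero[OF V left_translate_in[OF 3(2,1)]] 3
      by (simp add: left_field_def)
  qed
qed

lemma left_field_cong: "(\<And>i. i < n \<Longrightarrow> v i = w i) \<Longrightarrow> left_field v = left_field w"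
  unfolding left_field_def by (auto simp: fun_eq_iff)

lemma left_field_at_zero: "f \<in> smooth_funs M \<Longrightarrow>
  left_field v f (\<lambda>_. 0) = (\<Sum>i<n. v i * partial i f (\<lambda>_. 0))"
  by (simp add: left_field_def left_translate_zero)

lemma left_field_coord_fun_zero: "j < n \<Longrightarrow> left_field v (coord_fun n j) (\<lambda>_. 0) = v j"
proof -
  assume j: "j < n"
  have "partial i (coord_fun n j) (\<lambda>_. 0) = (if i = j then 1 else 0)" if "i < n" for i
    using partial_cong[of n "coord_fun n j" "\<lambda>x. x j" "\<lambda>_. 0" i] that by (simp add: coord_fun_def)
  then have "left_field v (coord_fun n j) (\<lambda>_. 0) = (\<Sum>i<n. if i = j then v i else 0)"
    unfolding left_field_at_zero[OF coord_fun_in] by (intro sum.cong) auto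
  then show ?thesis
    using j by simp
qed

lemma left_field_inject: "left_field v = left_field w \<longleftrightarrow> (\<forall>i<n. v i = w i)"
  using left_field_coord_fun_zero[of _ v] left_field_coord_fun_zero[of _ w] left_field_cong[of v w]
  by metis

lemma left_field_add: "left_field v + left_field w = left_field (\<lambda>i. v i + w i)"
  by (auto simp: left_field_def fun_eq_iff algebra_simps sum.distrib)

lemma left_field_scale: "oper_scale c (left_field v) = left_field (\<lambda>i. c * v i)"
  by (auto simp: left_field_def oper_scale_def fun_eq_iff algebra_simps sum_distrib_left)

lemma left_field_zero: "left_field (\<lambda>_. 0) = 0"
  by (auto simp: left_field_def fun_eq_iff)

text \<open>The bracket is again left invariant, so it is known once its values on the coordinate
  functions at the origin are; concrete brackets are computed in this way.\<close>

lemma lie_bracket_left_field: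
  "lie_bracket (left_field v) (left_field w) =
     left_field (\<lambda>i. lie_bracket (left_field v) (left_field w) (coord_fun n i) (\<lambda>_. 0))"
proof (rule lie_algebra_eq_left_field)
  have V: "vector_field M (left_field v)" for v
    using left_field_in by (simp add: lie_algebra_def)
  have L: "left_field v (left_translate G a f) = left_translate G a (left_field v f)"
    if "a \<in> carrier G" "f \<in> smooth_funs M" for v a f
    using left_field_in[of v] that by (simp add: lie_algebra_def)
  have "lie_bracket (left_field v) (left_field w) (left_translate G a f) =
      left_translate G a (lie_bracket (left_field v) (left_field w) f)"
    if "a \<in> carrier G" "f \<in> smooth_funs M" for a f
    unfolding lie_bracket_def L[OF that] L[OF that(1) left_field_smooth[OF that(2)]]
    by (auto simp: left_translate_def)
  then show "lie_bracket (left_field v) (left_field w) \<in> lie_algebra G M"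
    using lie_bracket_vector_field[OF V V] by (simp add: lie_algebra_def)
qed

section \<open>One-parameter subgroups in coordinates\<close>

lemma has_derivative_along_line:
  assumes f: "f \<in> smooth_funs M" and v: "v \<in> coord_space n"
  shows "((\<lambda>t. f (\<lambda>i. t * v i)) has_real_derivative left_field v f \<one>) (at 0)"
proof -
  have "((\<lambda>t. f (\<lambda>i. t * v i)) has_real_derivative
      (\<Sum>j<n. partial j f (\<lambda>i. 0 * v i) * v j)) (at 0)"
  proof (rule chain_rule)
    show "Ck n (Suc 0) f"
      using f by (simp only: smooth_funs_coord mem_Collect_eq smooth_Ck)
  qed (use v in \<open>auto simp: coord_space_def intro!: derivative_eq_intros\<close>)
  then show ?thesis
    using left_field_at_zero[OF f] by (simp add: one_eq mult.commute)
qed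

text \<open>The assumption \<open>hom\<close> is the mark of exponential coordinates: the straight
  line through the origin in direction \<open>v\<close> is a homomorphism.\<close>

lemma one_parameter_subgroup_line:
  assumes v: "v \<in> coord_space n"
    and hom: "\<And>s t. (\<lambda>i. (s + t) * v i) = (\<lambda>i. s * v i) \<otimes> (\<lambda>i. t * v i)"
  shows "one_parameter_subgroup G M (left_field v) (\<lambda>t i. t * v i)"
proof -
  let ?j = "\<lambda>t::real. \<lambda>i::nat. if i = 0 then t else 0" and ?g = "\<lambda>t i. t * v i"
  have in': "?g t \<in> coord_space n" for t
    using v by (simp add: coord_space_def)
  have inj: "inj ?j" by (rule injI) (metis (full_types))
  have ran: "range ?j = coord_space 1"
  proof safe
    fix x :: "nat \<Rightarrow> real" assume "x \<in> coord_space 1"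
    then show "x \<in> range ?j"
      by (intro image_eqI[of _ _ "x 0"]) (auto simp: coord_space_def fun_eq_iff)
  qed (auto simp: coord_space_def)
  have inv: "inv_into UNIV ?j x = x 0" if "x \<in> coord_space 1" for x
    using that by (intro inv_into_f_eq[OF inj]) (auto simp: coord_space_def fun_eq_iff)
  have "smooth 1 (\<lambda>x. inv_into UNIV ?j x * v i)" for i
    using smooth_cong[of 1 "\<lambda>x. inv_into UNIV ?j x * v i" "\<lambda>x. x 0 * v i"]
    by (simp add: inv smooth_mult)
  moreover have "UNIV \<inter> ?g -` coord_space n = UNIV"
    using in' by auto
  moreover have "continuous_on UNIV ?g"
    by (intro continuous_on_coordinatewise_then_product continuous_on_mult continuous_on_id
        continuous_on_const)
  then have "continuous_map euclideanreal (top_of_set (coord_space n)) ?g"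
    using in' by (simp add: continuous_map_in_subtopology image_subset_iff)
  ultimately have "smooth_map real_manifold M ?g"
    using in' by (auto simp: smooth_map_def real_manifold_def ran)
  then show ?thesis
    using hom has_derivative_along_line[OF _ v] by (simp add: one_parameter_subgroup_def)
qed

lemma one_parameter_subgroupD:
  assumes "one_parameter_subgroup G M (left_field v) \<gamma>"
  shows "\<gamma> t \<in> coord_space n" "\<gamma> (s + t) = \<gamma> s \<otimes> \<gamma> t"
    "i < n \<Longrightarrow> ((\<lambda>t. \<gamma> t i) has_real_derivative v i) (at 0)"
proof -
  have cont: "continuous_map euclideanreal (top_of_set (coord_space n)) \<gamma>"
    using assms by (simp add: one_parameter_subgroup_def smooth_map_def real_manifold_def)
  then show in': "\<gamma> t \<in> coord_space n" for t
    by (auto simp: continuous_map_in_subtopology)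
  show "\<gamma> (s + t) = \<gamma> s \<otimes> \<gamma> t"
    using assms by (simp add: one_parameter_subgroup_def)
  show "((\<lambda>t. \<gamma> t i) has_real_derivative v i) (at 0)" if "i < n"
  proof -
    have "((\<lambda>t. coord_fun n i (\<gamma> t)) has_real_derivative left_field v (coord_fun n i) \<one>) (at 0)"
      using assms coord_fun_in by (simp add: one_parameter_subgroup_def)
    then show ?thesis
      using in' unfolding one_eq left_field_coord_fun_zero[OF that] by (simp add: coord_fun_def)
  qed
qed

end

definition coord_unit :: "nat \<Rightarrow> nat \<Rightarrow> real" where
  "coord_unit i = (\<lambda>k. if k = i then 1 else 0)"

definition coord_subspace :: "nat \<Rightarrow> nat set \<Rightarrow> (nat \<Rightarrow> real) set" where
  "coord_subspace n I = {v \<in> coord_space n. \<forall>i. i \<notin> I \<longrightarrow> v i = 0}"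

lemma coord_unit_in: "i < n \<Longrightarrow> i \<in> I \<Longrightarrow> coord_unit i \<in> coord_subspace n I"
  by (auto simp: coord_unit_def coord_subspace_def coord_space_def)

context coord_lie_group
begin

text \<open>Left invariance replaces the value at p by the value at the identity of the translated
  coordinate, which is a derivative along a straight line. Left fields of an explicit product can
  thus be read off by differentiating in t.\<close>

lemma left_field_coord_funI:
  assumes "p \<in> coord_space n" "v \<in> coord_space n"
    and "((\<lambda>t. (p \<otimes> (\<lambda>i. t * v i)) j) has_real_derivative c) (at 0)"
  shows "left_field v (coord_fun n j) p = c"
proof -
  let ?f = "left_translate G p (coord_fun n j)"
  have f: "?f \<in> smooth_funs M"
    by (rule left_translate_in[OF assms(1) coord_fun_in])
  have "(\<lambda>i. t * v i) \<in> coord_space n" for t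
    using assms(2) by (simp add: coord_space_def)
  then have "?f (\<lambda>i. t * v i) = (p \<otimes> (\<lambda>i. t * v i)) j" for t
    using assms(1) by (simp add: left_translate_def carrier_eq coord_fun_def mult_in)
  then have "left_field v ?f \<one> = c"
    using has_derivative_along_line[OF f assms(2)] DERIV_unique[OF _ assms(3)] by simp
  moreover have "left_field v ?f = left_translate G p (left_field v (coord_fun n j))"
    using left_field_in[of v] assms(1) coord_fun_in by (simp add: lie_algebra_def carrier_eq)
  ultimately show ?thesis
    using assms(1) by (simp add: left_translate_def carrier_eq one_eq)
qed

lemma left_field_twice_coord_funI:
  assumes "v \<in> coord_space n"
    and "((\<lambda>t. left_field w (coord_fun n j) (\<lambda>i. t * v i)) has_real_derivative c) (at 0)"
  shows "left_field v (left_field w (coord_fun n j)) (\<lambda>_. 0) = c"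
  using has_derivative_along_line[OF left_field_smooth[OF coord_fun_in] assms(1)]
    DERIV_unique[OF _ assms(2)] by (simp add: one_eq)

lemma lie_algebra_eq: "lie_algebra G M = left_field ` coord_space n"
proof safe
  fix X assume "X \<in> lie_algebra G M"
  then have "X = left_field (\<lambda>i. X (coord_fun n i) (\<lambda>_. 0))"
    by (rule lie_algebra_eq_left_field)
  also have "\<dots> = left_field (\<lambda>i. if i < n then X (coord_fun n i) (\<lambda>_. 0) else 0)"
    by (rule left_field_cong) simp
  finally show "X \<in> left_field ` coord_space n"
    by (rule image_eqI[of X left_field]) (simp add: coord_space_def)
qed (rule left_field_in)

lemma left_field_sum: "(\<Sum>j\<in>J. left_field (w j)) = left_field (\<lambda>i. \<Sum>j\<in>J. w j i)"
  by (induction J rule: infinite_finite_induct) (simp_all add: left_field_zero left_field_add)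

lemma subspace_left_field: "oper.subspace (left_field ` coord_subspace n I)"
proof (rule oper.subspaceI)
  show "0 \<in> left_field ` coord_subspace n I"
    unfolding left_field_zero[symmetric] by (rule imageI) (simp add: coord_subspace_def)
next
  fix X Y assume "X \<in> left_field ` coord_subspace n I" "Y \<in> left_field ` coord_subspace n I"
  then obtain v w where "X = left_field v" "Y = left_field w"
    "v \<in> coord_subspace n I" "w \<in> coord_subspace n I" by blast
  then show "X + Y \<in> left_field ` coord_subspace n I"
    by (auto simp: left_field_add coord_subspace_def coord_space_def intro!: imageI)
next
  fix c X assume "X \<in> left_field ` coord_subspace n I"
  then obtain v where "X = left_field v" "v \<in> coord_subspace n I" by blast
  then show "oper_scale c X \<in> left_field ` coord_subspace n I"
    by (auto simp: left_field_scale coord_subspace_def coord_space_def intro!: imageI)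
qed

text \<open>\<open>discretizable\<close> counts its vectors by \<open>oper.dim\<close>, so
  dimensions must be found inside the space of operators; the fields of the unit vectors with index
  in \<open>I\<close> form a basis.\<close>

lemma dim_left_field:
  assumes I: "I \<subseteq> {..<n}"
  shows "oper.dim (left_field ` coord_subspace n I) = card I"
proof -
  let ?b = "\<lambda>i. left_field (coord_unit i)"
  have inj: "inj_on ?b I"
  proof (rule inj_onI)
    fix i j assume "i \<in> I" "j \<in> I" "?b i = ?b j"
    then have "coord_unit i i = coord_unit j i" using I by (auto simp: left_field_inject)
    then show "i = j" by (simp add: coord_unit_def split: if_splits)
  qed
  have fin: "finite I" using I finite_subset by blast
  have comb: "(\<Sum>i\<in>I. oper_scale (u i) (?b i)) = left_field (\<lambda>k. if k \<in> I then u k else 0)" for u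
  proof -
    have "(\<Sum>i\<in>I. u i * coord_unit i k) = (if k \<in> I then u k else 0)" for k
      using fin by (simp add: coord_unit_def if_distrib cong: if_cong)
    then show ?thesis by (simp add: left_field_scale left_field_sum)
  qed
  have "oper.independent (?b ` I)"
  proof
    assume "oper.dependent (?b ` I)"
    then obtain u i where i: "i \<in> I" "u (?b i) \<noteq> 0"
      and z: "(\<Sum>X\<in>?b ` I. oper_scale (u X) X) = 0"
      using oper.dependent_finite[of "?b ` I"] fin by auto
    have "left_field (\<lambda>k. if k \<in> I then u (?b k) else 0) = left_field (\<lambda>_. 0)"
      using z comb[of "\<lambda>i. u (?b i)"] by (simp add: sum.reindex[OF inj] left_field_zero)
    then have "\<forall>k<n. (if k \<in> I then u (?b k) else 0) = 0"
      by (simp only: left_field_inject)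
    then show False using i I by auto
  qed
  moreover have "oper.span (?b ` I) = left_field ` coord_subspace n I"
  proof
    show "oper.span (?b ` I) \<subseteq> left_field ` coord_subspace n I"
      by (rule oper.span_minimal) (use I coord_unit_in subspace_left_field in auto)
    show "left_field ` coord_subspace n I \<subseteq> oper.span (?b ` I)"
    proof safe
      fix v assume v: "v \<in> coord_subspace n I"
      have "(\<Sum>i\<in>I. oper_scale (v i) (?b i)) \<in> oper.span (?b ` I)"
        by (intro oper.span_sum oper.span_scale oper.span_base) auto
      moreover have "(\<lambda>k. if k \<in> I then v k else 0) = v"
        using v by (auto simp: coord_subspace_def)
      ultimately show "left_field v \<in> oper.span (?b ` I)"
        by (simp add: comb)
    qed
  qed
  ultimately have "oper.dim (left_field ` coord_subspace n I) = card (?b ` I)"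
    using oper.dim_span[of "?b ` I"] oper.dim_eq_card_independent[of "?b ` I"] by simp
  then show ?thesis
    by (simp add: card_image[OF inj])
qed

end

section \<open>The Cartan group\<close>

definition area :: "(nat \<Rightarrow> real) \<Rightarrow> (nat \<Rightarrow> real) \<Rightarrow> real" where
  "area p q = p 0 * q 1 - p 1 * q 0"

text \<open>The Baker--Campbell--Hausdorff product
  \<open>p + q + [p, q] / 2 + ([p, [p, q]] + [q, [q, p]]) / 12\<close> of the free nilpotent Lie algebra of step 3 on
  two generators \<open>e\<^sub>0, e\<^sub>1\<close>, in the basis \<open>e\<^sub>0\<close>, \<open>e\<^sub>1\<close>, \<open>e\<^sub>2 = [e\<^sub>0, e\<^sub>1]\<close>, \<open>e\<^sub>3 = [e\<^sub>0, e\<^sub>2]\<close>,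
  \<open>e\<^sub>4 = [e\<^sub>1, e\<^sub>2]\<close>; the index \<open>i - 3\<close> below is that of the generator bracketed with \<open>e\<^sub>2\<close>.\<close>

definition cartan_mult :: "(nat \<Rightarrow> real) \<Rightarrow> (nat \<Rightarrow> real) \<Rightarrow> nat \<Rightarrow> real" where
  "cartan_mult p q i = p i + q i +
     (if i = 2 then area p q / 2
      else if i = 3 \<or> i = 4 then
        (p (i - 3) * q 2 - p 2 * q (i - 3)) / 2 + (p (i - 3) - q (i - 3)) * area p q / 12
      else 0)"

definition cartan :: "(nat \<Rightarrow> real) monoid" where
  "cartan = \<lparr>carrier = coord_space 5, mult = cartan_mult, one = (\<lambda>_. 0)\<rparr>"

lemma cartan_simps [simp]:
  "carrier cartan = coord_space 5" "x \<otimes>\<^bsub>cartan\<^esub> y = cartan_mult x y" "\<one>\<^bsub>cartan\<^esub> = (\<lambda>_. 0)"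
  by (simp_all add: cartan_def)

lemma cartan_mult_in: "p \<in> coord_space 5 \<Longrightarrow> q \<in> coord_space 5 \<Longrightarrow> cartan_mult p q \<in> coord_space 5"
  by (auto simp: coord_space_def cartan_mult_def)

text \<open>Associativity is inherited from the Baker--Campbell--Hausdorff series, whose brackets of
  length over 3 vanish here; coordinatewise it is a polynomial identity.\<close>

lemma cartan_mult_assoc: "cartan_mult (cartan_mult p q) r = cartan_mult p (cartan_mult q r)"
proof
  fix i :: nat
  consider "i = 2" | "i = 3" | "i = 4" | "i \<notin> {2, 3, 4}" by blast
  then show "cartan_mult (cartan_mult p q) r i = cartan_mult p (cartan_mult q r) i"
    by cases (simp_all add: cartan_mult_def area_def field_simps)
qed

lemma group_cartan: "group cartan"
proof (rule groupI)
  fix x assume x: "x \<in> carrier cartan"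
  have "cartan_mult (\<lambda>i. - x i) x = (\<lambda>_. 0)"
    by (auto simp: cartan_mult_def area_def fun_eq_iff)
  then show "\<exists>y\<in>carrier cartan. y \<otimes>\<^bsub>cartan\<^esub> x = \<one>\<^bsub>cartan\<^esub>"
    using x by (intro bexI[of _ "\<lambda>i. - x i"]) (auto simp: coord_space_def)
  show "\<one>\<^bsub>cartan\<^esub> \<otimes>\<^bsub>cartan\<^esub> x = x"
    by (auto simp: cartan_mult_def area_def fun_eq_iff)
qed (simp_all add: cartan_mult_in cartan_mult_assoc)

lemma cartan_inv: "x \<in> coord_space 5 \<Longrightarrow> inv\<^bsub>cartan\<^esub> x = (\<lambda>i. - x i)"
proof (rule group.inv_equality[OF group_cartan])
  show "(\<lambda>i. - x i) \<otimes>\<^bsub>cartan\<^esub> x = \<one>\<^bsub>cartan\<^esub>"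
    by (auto simp: cartan_mult_def area_def fun_eq_iff)
qed (auto simp: coord_space_def)

global_interpretation cartan: coord_lie_group cartan 5
proof (rule coord_lie_group.intro[OF group_cartan], unfold_locales)
  show "smooth (5 + 5) (\<lambda>z. (lower_coords 5 z \<otimes>\<^bsub>cartan\<^esub> upper_coords 5 z) j)" if "j < 5" for j
  proof -
    have lu: "smooth m (\<lambda>z. lower_coords 5 z i)" "smooth m (\<lambda>z. upper_coords 5 z i)" for i m
      by (cases "i < 5"; simp add: lower_coords_def upper_coords_def)+
    have half: "smooth m (\<lambda>z. f z / c)" if "smooth m f" for f c m
      using smooth_mult[OF that smooth_const[of _ "1 / c"]] by simp
    consider "j = 2" | "j = 3 \<or> j = 4" | "j \<notin> {2, 3, 4}" by blast
    then show ?thesis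
      by cases (auto simp: cartan_mult_def area_def intro!: half smooth_add smooth_diff smooth_mult lu)
  qed
  show "smooth 5 (\<lambda>x. (inv\<^bsub>cartan\<^esub> x) j)" for j
    using smooth_cong[of 5 "\<lambda>x. (inv\<^bsub>cartan\<^esub> x) j" "\<lambda>x. - x j"]
    by (simp add: cartan_inv smooth_minus)
qed simp_all

section \<open>The Lie bracket of the Cartan group\<close>

definition cartan_bracket :: "(nat \<Rightarrow> real) \<Rightarrow> (nat \<Rightarrow> real) \<Rightarrow> nat \<Rightarrow> real" where
  "cartan_bracket v w i =
     (if i = 2 then area v w
      else if i = 3 \<or> i = 4 then v (i - 3) * w 2 - v 2 * w (i - 3) else 0)"

text \<open>The derivative keeps the part of the product that is linear in the right factor. Of the
  term with 12 only \<open>p (j - 3) * area p w\<close> survives, because \<open>area\<close>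
  already carries one factor t.\<close>

lemma cartan_left_field_coord:
  assumes p: "p \<in> coord_space 5" and w: "w \<in> coord_space 5"
  shows "cartan.left_field w (coord_fun 5 j) p = w j +
     (if j = 2 then area p w / 2
      else if j = 3 \<or> j = 4 then
        (p (j - 3) * w 2 - p 2 * w (j - 3)) / 2 + p (j - 3) * area p w / 12
      else 0)"
proof (rule cartan.left_field_coord_funI[OF p w])
  consider "j = 2" | "j = 3 \<or> j = 4" | "j \<notin> {2, 3, 4}" by blast
  then show "((\<lambda>t. (p \<otimes>\<^bsub>cartan\<^esub> (\<lambda>i. t * w i)) j) has_real_derivative w j +
     (if j = 2 then area p w / 2
      else if j = 3 \<or> j = 4 then
        (p (j - 3) * w 2 - p 2 * w (j - 3)) / 2 + p (j - 3) * area p w / 12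
      else 0)) (at 0)"
    by cases (auto simp: cartan_mult_def area_def field_simps intro!: derivative_eq_intros)
qed

lemma cartan_lie_bracket:
  assumes v: "v \<in> coord_space 5" and w: "w \<in> coord_space 5"
  shows "lie_bracket (cartan.left_field v) (cartan.left_field w) =
     cartan.left_field (cartan_bracket v w)"
proof -
  \<comment> \<open>At the origin half of the bracket is left, the term with 12 being quadratic in
    the base point. Antisymmetrising restores the full bracket.\<close>
  have twice: "cartan.left_field v (cartan.left_field w (coord_fun 5 j)) (\<lambda>_. 0) =
     (if j = 2 then area v w / 2
      else if j = 3 \<or> j = 4 then (v (j - 3) * w 2 - v 2 * w (j - 3)) / 2 else 0)"
    if v: "v \<in> coord_space 5" and w: "w \<in> coord_space 5" for v w j
  proof (rule cartan.left_field_twice_coord_funI[OF v])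
    have tv: "(\<lambda>i. t * v i) \<in> coord_space 5" for t
      using v by (simp add: coord_space_def)
    consider "j = 2" | "j = 3 \<or> j = 4" | "j \<notin> {2, 3, 4}" by blast
    then show "((\<lambda>t. cartan.left_field w (coord_fun 5 j) (\<lambda>i. t * v i)) has_real_derivative
       (if j = 2 then area v w / 2
        else if j = 3 \<or> j = 4 then (v (j - 3) * w 2 - v 2 * w (j - 3)) / 2 else 0)) (at 0)"
      unfolding cartan_left_field_coord[OF tv w]
      by cases (auto simp: area_def field_simps intro!: derivative_eq_intros)
  qed
  have "lie_bracket (cartan.left_field v) (cartan.left_field w) (coord_fun 5 i) (\<lambda>_. 0) =
      cartan_bracket v w i" for i
    by (auto simp: lie_bracket_def twice v w cartan_bracket_def area_def field_simps)
  then show ?thesis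
    by (subst cartan.lie_bracket_left_field) (simp only:)
qed

section \<open>The exponential map of the Cartan group\<close>

lemma additive_real_linear:
  fixes \<phi> :: "real \<Rightarrow> real"
  assumes add: "\<And>s t. \<phi> (s + t) = \<phi> s + \<phi> t" and d: "(\<phi> has_real_derivative a) (at 0)"
  shows "\<phi> t = t * a"
proof -
  \<comment> \<open>Additivity transports the derivative at 0 to every x: an increment does not
    depend on where it starts.\<close>
  have "(\<phi> has_real_derivative a) (at x)" for x
  proof -
    have "((\<lambda>h. \<phi> x + \<phi> h) has_real_derivative a) (at 0)"
      using d by (auto intro!: derivative_eq_intros)
    then have "((\<lambda>h. \<phi> (h + x)) has_real_derivative a) (at 0)"
      by (simp add: add add.commute)
    then show ?thesis
      using DERIV_shift[of \<phi> a 0 x] by simp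
  qed
  then have "((\<lambda>x. \<phi> x - x * a) has_real_derivative 0) (at x)" for x
    by (auto intro!: derivative_eq_intros)
  then have "\<phi> t - t * a = \<phi> 0 - 0 * a"
    using DERIV_isconst_all[of "\<lambda>x. \<phi> x - x * a"] by blast
  moreover have "\<phi> 0 = 0" using add[of 0 0] by simp
  ultimately show ?thesis by simp
qed

lemma cartan_line_hom:
  "(\<lambda>i. (s + t) * v i) = (\<lambda>i. s * v i) \<otimes>\<^bsub>cartan\<^esub> (\<lambda>i. t * v i)"
  by (auto simp: cartan_mult_def area_def algebra_simps fun_eq_iff)

text \<open>Coordinates are solved layer by layer. Once those of the lower layers are linear in t,
  \<open>\<gamma> s\<close> and \<open>\<gamma> t\<close> are parallel in them, the correction terms
  of the product cancel, and the next coordinate is additive.\<close>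

lemma cartan_one_parameter_unique:
  assumes v: "v \<in> coord_space 5"
    and \<gamma>: "one_parameter_subgroup cartan cartan.M (cartan.left_field v) \<gamma>"
  shows "\<gamma> = (\<lambda>t i. t * v i)"
proof -
  note D = cartan.one_parameter_subgroupD[OF \<gamma>]
  have hom: "\<gamma> (s + t) i = cartan_mult (\<gamma> s) (\<gamma> t) i" for s t i
    using D(2) by simp
  have xy: "\<gamma> t i = t * v i" if "i < 2" for i t
    by (rule additive_real_linear[OF _ D(3)]) (use that in \<open>auto simp: hom cartan_mult_def\<close>)
  have z: "\<gamma> t 2 = t * v 2" for t
    by (rule additive_real_linear[OF _ D(3)]) (auto simp: hom cartan_mult_def area_def xy)
  have uv: "\<gamma> t i = t * v i" if "i = 3 \<or> i = 4" for i t
    by (rule additive_real_linear[OF _ D(3)])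
      (use that in \<open>auto simp: hom cartan_mult_def area_def xy z\<close>)
  have "\<gamma> t i = t * v i" for t i
  proof (cases "i < 5")
    case True
    then consider "i < 2" | "i = 2" | "i = 3 \<or> i = 4" by linarith
    then show ?thesis by cases (simp_all add: xy z uv)
  next
    case False
    then show ?thesis using v D(1) by (simp add: coord_space_def)
  qed
  then show ?thesis by blast
qed

text \<open>\<open>lie_exp\<close> is a definite description, so existence and uniqueness of the
  one-parameter subgroup both enter. From here on exponentials are the coordinate vectors
  themselves.\<close>

lemma cartan_exp:
  assumes v: "v \<in> coord_space 5"
  shows "lie_exp cartan cartan.M (cartan.left_field v) = v"
proof -
  have "(THE \<gamma>. one_parameter_subgroup cartan cartan.M (cartan.left_field v) \<gamma>) = (\<lambda>t i. t * v i)"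
    by (rule the_equality)
      (use v cartan.one_parameter_subgroup_line cartan_line_hom cartan_one_parameter_unique in blast)+
  then show ?thesis by (simp add: lie_exp_def)
qed

section \<open>The stratification\<close>

definition layer_coords :: "nat \<Rightarrow> nat set" where
  "layer_coords j = (if j = 1 then {0, 1} else if j = 2 then {2} else if j = 3 then {3, 4} else {})"

definition layer :: "nat \<Rightarrow> (nat \<Rightarrow> real) oper set" where
  "layer j = cartan.left_field ` coord_subspace 5 (layer_coords j)"

lemma layer_coords_subset: "layer_coords j \<subseteq> {..<5}"
  by (auto simp: layer_coords_def)

lemma coord_subspace_in: "v \<in> coord_subspace n I \<Longrightarrow> v \<in> coord_space n"
  by (simp add: coord_subspace_def)

lemma dim_layer: "oper.dim (layer j) = card (layer_coords j)"
  unfolding layer_def by (rule cartan.dim_left_field[OF layer_coords_subset])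

lemma subspace_layer: "oper.subspace (layer j)"
  unfolding layer_def by (rule cartan.subspace_left_field)

lemma restrict_in_layer:
  "v \<in> coord_space 5 \<Longrightarrow> cartan.left_field (\<lambda>i. if i \<in> layer_coords j then v i else 0) \<in> layer j"
  unfolding layer_def by (rule imageI) (simp add: coord_subspace_def coord_space_def)

text \<open>The index set \<open>J\<close> is arbitrary because the lemma serves twice: with {1..3}
  for the whole Lie algebra, and with {2..3} for the subspace whose exponential contains the
  commutator.\<close>

lemma left_field_in_span_layers:
  assumes v: "v \<in> coord_space 5" and zero: "\<And>i. i < 5 \<Longrightarrow> i \<notin> (\<Union>j\<in>J. layer_coords j) \<Longrightarrow> v i = 0"
  shows "cartan.left_field v \<in> oper.span (\<Union>j\<in>J. layer j)"
proof -
  \<comment> \<open>\<open>J\<close> may be infinite, where a HOL sum would collapse to 0; layers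
    other than 1, 2 and 3 have no coordinates.\<close>
  have "v = (\<lambda>i. \<Sum>j\<in>{1,2,3} \<inter> J. if i \<in> layer_coords j then v i else 0)"
  proof
    fix i :: nat
    consider "i = 0 \<or> i = 1" | "i = 2" | "i = 3 \<or> i = 4" | "5 \<le> i" by linarith
    then show "v i = (\<Sum>j\<in>{1,2,3} \<inter> J. if i \<in> layer_coords j then v i else 0)"
    proof cases
      case 4
      then have "v i = 0" using v by (simp add: coord_space_def)
      then show ?thesis by (auto intro!: sum.neutral)
    qed (use zero[of i] in \<open>auto simp: layer_coords_def sum.inter_restrict\<close>)
  qed
  then have "cartan.left_field v =
      (\<Sum>j\<in>{1,2,3} \<inter> J. cartan.left_field (\<lambda>i. if i \<in> layer_coords j then v i else 0))"
    by (simp add: cartan.left_field_sum)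
  also have "\<dots> \<in> oper.span (\<Union>j\<in>J. layer j)"
    by (intro oper.span_sum oper.span_base) (use restrict_in_layer[OF v] in blast)
  finally show ?thesis .
qed

lemma stratification_cartan: "stratification cartan cartan.M 3 layer"
  unfolding stratification_def
proof (intro conjI allI impI)
  show "oper.subspace (layer j)" for j
    by (rule subspace_layer)
  have triv: "layer k = {0}" if "layer_coords k = {}" for k
  proof -
    have "coord_subspace 5 (layer_coords k) = {\<lambda>_. 0}"
      using that by (auto simp: coord_subspace_def)
    then show ?thesis by (simp add: layer_def cartan.left_field_zero)
  qed
  then show "layer k = {0}" if "k > 3" for k
    using that by (simp add: layer_coords_def)
  show "oper.span (\<Union>j\<in>{1..3}. layer j) = lie_algebra cartan cartan.M"
  proof
    have "oper.subspace (lie_algebra cartan cartan.M)"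
      using cartan.subspace_left_field[of UNIV] by (simp add: cartan.lie_algebra_eq coord_subspace_def)
    then show "oper.span (\<Union>j\<in>{1..3}. layer j) \<subseteq> lie_algebra cartan cartan.M"
      by (intro oper.span_minimal) (auto simp: layer_def cartan.left_field_in)
    show "lie_algebra cartan cartan.M \<subseteq> oper.span (\<Union>j\<in>{1..3}. layer j)"
    proof
      fix X assume "X \<in> lie_algebra cartan cartan.M"
      then obtain v where v: "v \<in> coord_space 5" and X: "X = cartan.left_field v"
        by (auto simp: cartan.lie_algebra_eq)
      have "i \<in> (\<Union>j\<in>{1..3}. layer_coords j)" if "i < 5" for i
      proof -
        let ?j = "if i < 2 then 1 else if i = 2 then 2 else 3 :: nat"
        have "i \<in> layer_coords ?j" "?j \<in> {1..3}"
          using that by (auto simp: layer_coords_def)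
        then show ?thesis by blast
      qed
      then show "X \<in> oper.span (\<Union>j\<in>{1..3}. layer j)"
        unfolding X by (intro left_field_in_span_layers v) blast
    qed
  qed
  show "\<forall>j\<in>{1..3}. X j = 0" if "(\<forall>j\<in>{1..3}. X j \<in> layer j) \<and> (\<Sum>j\<in>{1..3}. X j) = 0" for X
  proof -
    have "\<forall>j\<in>{1..3}. \<exists>w. w \<in> coord_subspace 5 (layer_coords j) \<and> X j = cartan.left_field w"
      using that by (auto simp: layer_def)
    then obtain w where w: "\<And>j. j \<in> {1..3} \<Longrightarrow> w j \<in> coord_subspace 5 (layer_coords j)"
      "\<And>j. j \<in> {1..3} \<Longrightarrow> X j = cartan.left_field (w j)"
      by metis
    have "cartan.left_field (\<lambda>i. \<Sum>j\<in>{1..3}. w j i) = (\<Sum>j\<in>{1..3}. X j)"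
      unfolding cartan.left_field_sum[symmetric] by (intro sum.cong) (simp_all add: w)
    also have "\<dots> = cartan.left_field (\<lambda>_. 0)"
      using that by (simp add: cartan.left_field_zero)
    finally have sum0: "(\<Sum>j\<in>{1..3}. w j i) = 0" if "i < 5" for i
      using that by (simp only: cartan.left_field_inject)
    have "w j i = 0" if j: "j \<in> {1..3}" for i j
    proof (cases "i \<in> layer_coords j")
      case True
      \<comment> \<open>Distinct layers use disjoint coordinates, so coordinate i of the vanishing
        sum sees a single summand.\<close>
      have "w k i = 0" if "k \<in> {1..3}" "k \<noteq> j" for k
      proof -
        have "i \<notin> layer_coords k"
          using True that(2) by (auto simp: layer_coords_def split: if_splits)
        then show ?thesis
          using w(1)[OF that(1)] by (simp add: coord_subspace_def)
      qed
      then have "(\<Sum>k\<in>{1..3}. w k i) = w j i"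
        using j by (subst sum.remove[of _ j]) auto
      then show ?thesis
        using sum0[of i] True layer_coords_subset by auto
    next
      case False
      then show ?thesis using w(1)[OF j] by (simp add: coord_subspace_def)
    qed
    then have "w j = (\<lambda>_. 0)" if "j \<in> {1..3}" for j
      using that by blast
    then show ?thesis
      by (simp add: w cartan.left_field_zero)
  qed
  show "oper.span {lie_bracket X Y | X Y. X \<in> layer 1 \<and> Y \<in> layer j} = layer (j + 1)"
    if "j \<ge> 1" for j
  proof
    let ?B = "{lie_bracket X Y | X Y. X \<in> layer 1 \<and> Y \<in> layer j}"
    show "oper.span ?B \<subseteq> layer (j + 1)"
    proof (rule oper.span_minimal[OF _ subspace_layer], safe)
      fix X Y assume "X \<in> layer 1" "Y \<in> layer j"
      then obtain v w where v: "v \<in> coord_subspace 5 (layer_coords 1)" "X = cartan.left_field v"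
        and w: "w \<in> coord_subspace 5 (layer_coords j)" "Y = cartan.left_field w"
        by (auto simp: layer_def)
      \<comment> \<open>Brackets send layers 1, 1 to 2 and layers 1, 2 to 3. For j at least 3 the
        bracket is 0, because \<open>w\<close> has no entries below index 3.\<close>
      have "cartan_bracket v w \<in> coord_subspace 5 (layer_coords (j + 1))"
        using v(1) w(1) \<open>j \<ge> 1\<close>
        by (auto simp: coord_subspace_def coord_space_def cartan_bracket_def area_def layer_coords_def
            split: if_splits)
      then show "lie_bracket X Y \<in> layer (j + 1)"
        unfolding v(2) w(2) cartan_lie_bracket[OF v(1)[THEN coord_subspace_in] w(1)[THEN coord_subspace_in]]
        by (simp add: layer_def)
    qed
    show "layer (j + 1) \<subseteq> oper.span ?B"
    proof
      fix X assume X: "X \<in> layer (j + 1)"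
      have br: "cartan.left_field (cartan_bracket v w) \<in> oper.span ?B"
        if "v \<in> coord_subspace 5 (layer_coords 1)" "w \<in> coord_subspace 5 (layer_coords j)" for v w
        using that cartan_lie_bracket[OF coord_subspace_in coord_subspace_in, OF that]
        by (intro oper.span_base) (force simp: layer_def)
      obtain v where v: "v \<in> coord_subspace 5 (layer_coords (j + 1))" "X = cartan.left_field v"
        using X by (auto simp: layer_def)
      consider "j = 1" | "j = 2" | "j \<ge> 3" using \<open>j \<ge> 1\<close> by linarith
      then show "X \<in> oper.span ?B"
      proof cases
        case 1
        have "v i = v 2 * cartan_bracket (coord_unit 0) (coord_unit 1) i" for i
          using v(1) 1 by (auto simp: coord_subspace_def layer_coords_def cartan_bracket_def area_def coord_unit_def)
        then have "X = oper_scale (v 2) (cartan.left_field (cartan_bracket (coord_unit 0) (coord_unit 1)))"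
          unfolding v(2) cartan.left_field_scale by (intro cartan.left_field_cong)
        also have "\<dots> \<in> oper.span ?B"
          by (intro oper.span_scale br coord_unit_in) (auto simp: 1 layer_coords_def)
        finally show ?thesis .
      next
        case 2
        have "v i = v 3 * cartan_bracket (coord_unit 0) (coord_unit 2) i + v 4 * cartan_bracket (coord_unit 1) (coord_unit 2) i" for i
          using v(1) 2 by (auto simp: coord_subspace_def layer_coords_def cartan_bracket_def area_def coord_unit_def)
        then have "X = oper_scale (v 3) (cartan.left_field (cartan_bracket (coord_unit 0) (coord_unit 2)))
            + oper_scale (v 4) (cartan.left_field (cartan_bracket (coord_unit 1) (coord_unit 2)))"
          unfolding v(2) cartan.left_field_scale cartan.left_field_add by (intro cartan.left_field_cong)
        also have "\<dots> \<in> oper.span ?B"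
          by (intro oper.span_add oper.span_scale br coord_unit_in) (auto simp: 2 layer_coords_def)
        finally show ?thesis .
      next
        case 3
        then have "X = 0" using X triv[of "j + 1"] by (simp add: layer_coords_def)
        then show ?thesis by (simp add: oper.span_zero)
      qed
    qed
  qed
qed

lemma carnot_group_cartan: "carnot_group cartan cartan.M 3 layer"
  unfolding carnot_group_def
  using cartan.lie_group simply_connected_coord stratification_cartan by blast

section \<open>Integrality in the generated subgroup\<close>

text \<open>The elements \<open>exp (i p) exp (j q) c\<^sup>k\<close> times an integral element of the centre, where \<open>c\<close> is the
  commutator of \<open>exp p\<close> and \<open>exp q\<close>. Of the central coordinates only the component along \<open>p\<close> is
  recorded, which pairing with \<open>q\<close> extracts.\<close>

definition lattice_hull :: "(nat \<Rightarrow> real) \<Rightarrow> (nat \<Rightarrow> real) \<Rightarrow> (nat \<Rightarrow> real) set" where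
  "lattice_hull p q = {a. \<exists>i\<in>\<int>. \<exists>j\<in>\<int>. \<exists>k\<in>\<int>. \<exists>l\<in>\<int>.
     a 0 = i * p 0 + j * q 0 \<and> a 1 = i * p 1 + j * q 1 \<and>
     a 2 = area p q * (i * j / 2 + k) \<and>
     a 3 * q 1 - a 4 * q 0 = (area p q)\<^sup>2 * (i\<^sup>2 * j / 12 + k * (1 + i) / 2 + l)}"

lemma lattice_hullI:
  assumes "i \<in> \<int>" "j \<in> \<int>" "k \<in> \<int>" "l \<in> \<int>"
    "a 0 = i * p 0 + j * q 0" "a 1 = i * p 1 + j * q 1"
    "a 2 = area p q * (i * j / 2 + k)"
    "a 3 * q 1 - a 4 * q 0 = (area p q)\<^sup>2 * (i\<^sup>2 * j / 12 + k * (1 + i) / 2 + l)"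
  shows "a \<in> lattice_hull p q"
  using assms unfolding lattice_hull_def by blast

text \<open>In units of \<open>area p q\<close>, right multiplication by \<open>p\<close> lowers
  coordinate 2 by j / 2 while i * j / 2 grows by j / 2, so k must drop by j. The pairing with
  \<open>q\<close> then forces the new l, in which all fractions have cancelled. The factor
  \<open>q\<close> changes neither k nor l: moving it past the commutators costs only multiples of
  \<open>[q, z]\<close>, invisible to the pairing.\<close>

lemma lattice_hull_mult:
  assumes a: "a \<in> lattice_hull p q" and layer: "p 2 = 0" "p 3 = 0" "p 4 = 0" "q 2 = 0" "q 3 = 0" "q 4 = 0"
  shows "cartan_mult a p \<in> lattice_hull p q" "cartan_mult a (\<lambda>i. - p i) \<in> lattice_hull p q"
    "cartan_mult a q \<in> lattice_hull p q" "cartan_mult a (\<lambda>i. - q i) \<in> lattice_hull p q"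
proof -
  obtain i j k l where int: "i \<in> \<int>" "j \<in> \<int>" "k \<in> \<int>" "l \<in> \<int>"
    and 0: "a 0 = i * p 0 + j * q 0" "a 1 = i * p 1 + j * q 1"
    and 2: "a 2 = area p q * (i * j / 2 + k)"
    and 3: "a 3 * q 1 - a 4 * q 0 = (area p q)\<^sup>2 * (i\<^sup>2 * j / 12 + k * (1 + i) / 2 + l)"
    using a unfolding lattice_hull_def by blast
  have ap: "area a p = - j * area p q" and aq: "area a q = i * area p q"
    by (simp_all add: area_def 0 0[unfolded One_nat_def] algebra_simps)
  have neg: "area a (\<lambda>i. - b i) = - area a b" for b
    by (simp add: area_def)
  have z: "cartan_mult a b 2 = a 2 + b 2 + area a b / 2" for b
    by (simp add: cartan_mult_def)
  \<comment> \<open>Entries 0 and 1 of a vector, placed at 3 and 4, pair with \<open>q\<close> to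
    its \<open>area\<close> with \<open>q\<close>, so the two central coordinates of the product
    merge into one scalar formula.\<close>
  have u: "cartan_mult a b 3 * q 1 - cartan_mult a b 4 * q 0 =
      (a 3 * q 1 - a 4 * q 0) - a 2 * area b q / 2 + (area a q - area b q) * area a b / 12"
    if "b 2 = 0" "b 3 = 0" "b 4 = 0" for b
    using that by (simp add: cartan_mult_def area_def field_simps)
  have negq: "area (\<lambda>i. - b i) q = - area b q" for b
    by (simp add: area_def)
  have qq: "area q q = 0" by (simp add: area_def)
  show "cartan_mult a p \<in> lattice_hull p q"
  proof (rule lattice_hullI[where i="i + 1" and j="j" and k="k - j" and l="l - k + j"])
    show "cartan_mult a p 2 = area p q * ((i + 1) * (j) / 2 + (k - j))"
      unfolding z ap aq 2 using layer by (simp add: field_simps)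
    show "cartan_mult a p 3 * q 1 - cartan_mult a p 4 * q 0 =
        (area p q)\<^sup>2 * ((i + 1)\<^sup>2 * (j) / 12 + (k - j) * (1 + (i + 1)) / 2 + (l - k + j))"
      by (subst u, simp_all only: 2 3 ap aq, simp_all add: layer power2_eq_square field_simps)
  qed (use int in \<open>simp_all add: cartan_mult_def 0 0[unfolded One_nat_def] algebra_simps\<close>)
  show "cartan_mult a (\<lambda>i. - p i) \<in> lattice_hull p q"
  proof (rule lattice_hullI[where i="i - 1" and j="j" and k="k + j" and l="l + k"])
    show "cartan_mult a (\<lambda>i. - p i) 2 = area p q * ((i - 1) * (j) / 2 + (k + j))"
      unfolding z ap aq neg negq 2 using layer by (simp add: field_simps)
    show "cartan_mult a (\<lambda>i. - p i) 3 * q 1 - cartan_mult a (\<lambda>i. - p i) 4 * q 0 =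
        (area p q)\<^sup>2 * ((i - 1)\<^sup>2 * (j) / 12 + (k + j) * (1 + (i - 1)) / 2 + (l + k))"
      by (subst u, simp_all only: 2 3 ap aq neg negq, simp_all add: layer power2_eq_square field_simps)
  qed (use int in \<open>simp_all add: cartan_mult_def 0 0[unfolded One_nat_def] algebra_simps\<close>)
  show "cartan_mult a q \<in> lattice_hull p q"
  proof (rule lattice_hullI[where i="i" and j="j + 1" and k="k" and l="l"])
    show "cartan_mult a q 2 = area p q * ((i) * (j + 1) / 2 + (k))"
      unfolding z ap aq qq 2 using layer by (simp add: field_simps)
    show "cartan_mult a q 3 * q 1 - cartan_mult a q 4 * q 0 =
        (area p q)\<^sup>2 * ((i)\<^sup>2 * (j + 1) / 12 + (k) * (1 + (i)) / 2 + (l))"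
      by (subst u, simp_all only: 2 3 ap aq qq, simp_all add: layer power2_eq_square field_simps)
  qed (use int in \<open>simp_all add: cartan_mult_def 0 0[unfolded One_nat_def] algebra_simps\<close>)
  show "cartan_mult a (\<lambda>i. - q i) \<in> lattice_hull p q"
  proof (rule lattice_hullI[where i="i" and j="j - 1" and k="k" and l="l"])
    show "cartan_mult a (\<lambda>i. - q i) 2 = area p q * ((i) * (j - 1) / 2 + (k))"
      unfolding z ap aq qq neg negq 2 using layer by (simp add: field_simps)
    show "cartan_mult a (\<lambda>i. - q i) 3 * q 1 - cartan_mult a (\<lambda>i. - q i) 4 * q 0 =
        (area p q)\<^sup>2 * ((i)\<^sup>2 * (j - 1) / 12 + (k) * (1 + (i)) / 2 + (l))"
      by (subst u, simp_all only: 2 3 ap aq qq neg negq, simp_all add: layer power2_eq_square field_simps)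
  qed (use int in \<open>simp_all add: cartan_mult_def 0 0[unfolded One_nat_def] algebra_simps\<close>)
qed

lemma generate_in_lattice_hull:
  assumes p: "p \<in> coord_subspace 5 (layer_coords 1)" and q: "q \<in> coord_subspace 5 (layer_coords 1)"
    and h: "h \<in> generate cartan {p, q}"
  shows "h \<in> lattice_hull p q"
proof -
  have pq: "p \<in> coord_space 5" "q \<in> coord_space 5"
    and layer: "p 2 = 0" "p 3 = 0" "p 4 = 0" "q 2 = 0" "q 3 = 0" "q 4 = 0"
    using p q by (auto simp: coord_subspace_def layer_coords_def)
  \<comment> \<open>Membership of h alone would not pass through products, since the hull is only
    known to be stable under right multiplication by generators and their inverses. Stability under
    right multiplication by h does compose, and applied to the identity it returns
    membership.\<close>
  have closed: "\<forall>a\<in>lattice_hull p q. cartan_mult a h \<in> lattice_hull p q"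
    using h
  proof (induction rule: generate.induct)
    case one
    have "cartan_mult a (\<lambda>_. 0) = a" for a
      by (simp add: cartan_mult_def area_def fun_eq_iff)
    then show ?case by simp
  next
    case (incl h)
    then show ?case using lattice_hull_mult(1,3)[OF _ layer] by auto
  next
    case (inv h)
    then show ?case using lattice_hull_mult(2,4)[OF _ layer] pq by (auto simp: cartan_inv)
  next
    case (eng h1 h2)
    then show ?case by (simp flip: cartan_mult_assoc)
  qed
  have "(\<lambda>_. 0) \<in> lattice_hull p q"
    by (rule lattice_hullI[where i=0 and j=0 and k=0 and l=0]) simp_all
  moreover have "cartan_mult (\<lambda>_. 0) h = h"
    by (simp add: cartan_mult_def area_def fun_eq_iff)
  ultimately show ?thesis using bspec[OF closed] by fastforce
qed

text \<open>Where the first two coordinates vanish so does \<open>area\<close>, and coordinate 2 is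
  additive. With \<open>m\<close> = \<open>s 2\<close> this bounds the group generated by
  \<open>s\<close> and elements of the third layer.\<close>

lemma subgroup_integral_height:
  "subgroup {v \<in> coord_space 5. v 0 = 0 \<and> v 1 = 0 \<and> (\<exists>k\<in>\<int>. v 2 = k * m)} cartan" (is "subgroup ?K cartan")
proof (rule group.subgroupI[OF group_cartan])
  show "?K \<noteq> {}" by (auto intro!: exI[of _ "\<lambda>_. 0"] bexI[of _ 0])
  fix a assume a: "a \<in> ?K"
  then obtain k where k: "k \<in> \<int>" "a 2 = k * m" by blast
  show "inv\<^bsub>cartan\<^esub> a \<in> ?K"
    using a by (auto simp: cartan_inv coord_space_def k intro!: bexI[of _ "- k"])
  fix b assume b: "b \<in> ?K"
  then obtain l where l: "l \<in> \<int>" "b 2 = l * m" by blast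
  have "cartan_mult a b 2 = (k + l) * m"
    using a b by (simp add: cartan_mult_def area_def k l algebra_simps)
  moreover have "cartan_mult a b 0 = 0" "cartan_mult a b 1 = 0"
    using a b by (simp_all add: cartan_mult_def)
  moreover have "cartan_mult a b \<in> coord_space 5"
    using a b by (simp add: cartan_mult_in)
  ultimately show "a \<otimes>\<^bsub>cartan\<^esub> b \<in> ?K"
    using Ints_add[OF k(1) l(1)] by auto
qed auto

text \<open>The intersection condition at level 2 is used in both directions. From left to right it
  makes the height \<open>area p q\<close> of the commutator an integral multiple of
  \<open>s 2\<close>; from right to left it puts \<open>s\<close> into the group generated by
  \<open>p\<close> and \<open>q\<close>, where its height is an even multiple of
  \<open>area p q\<close>.\<close>

lemma not_discretizable_cartan: "\<not> discretizable cartan cartan.M 3 layer"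
proof
  assume "discretizable cartan cartan.M 3 layer"
  then obtain X where X_span: "\<forall>j\<in>{1..3}. (\<forall>i\<in>{1..oper.dim (layer j)}. X j i \<in> layer j) \<and>
        oper.span {X j i | i. i \<in> {1..oper.dim (layer j)}} = layer j"
    and inter: "\<forall>j\<in>{1..3}.
      generate cartan {lie_exp cartan cartan.M (X 1 i) | i. i \<in> {1..oper.dim (layer 1)}} \<inter>
        lie_exp cartan cartan.M ` oper.span (\<Union>k\<in>{j..3}. layer k) =
      generate cartan {lie_exp cartan cartan.M (X k i) | k i. k \<in> {j..3} \<and> i \<in> {1..oper.dim (layer k)}}"
    unfolding discretizable_def Let_def by (elim exE conjE) (rule that)
  have X: "X j i \<in> layer j" if "j \<in> {1..3}" "i \<in> {1..oper.dim (layer j)}" for j i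
    using X_span that by blast
  have span: "oper.span {X j i | i. i \<in> {1..oper.dim (layer j)}} = layer j" if "j \<in> {1..3}" for j
    using X_span that by blast
  \<comment> \<open>The second layer is a line, so a single vector \<open>s\<close> has to account
    for coordinate 2.\<close>
  have dims: "{1..oper.dim (layer 1)} = {1, 2}" "{1..oper.dim (layer 2)} = {1}"
    by (auto simp: dim_layer layer_coords_def)
  then have mem: "1 \<in> {1..oper.dim (layer 1)}" "2 \<in> {1..oper.dim (layer 1)}"
    "1 \<in> {1..oper.dim (layer 2)}"
    by blast+
  have "X 1 1 \<in> layer 1" "X 1 2 \<in> layer 1" "X 2 1 \<in> layer 2"
    using X[OF _ mem(1)] X[OF _ mem(2)] X[OF _ mem(3)] by simp_all
  then obtain p q s where p: "p \<in> coord_subspace 5 (layer_coords 1)" "X 1 1 = cartan.left_field p"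
    and q: "q \<in> coord_subspace 5 (layer_coords 1)" "X 1 2 = cartan.left_field q"
    and s: "s \<in> coord_subspace 5 (layer_coords 2)" "X 2 1 = cartan.left_field s"
    unfolding layer_def by blast
  note in5 = p(1)[THEN coord_subspace_in] q(1)[THEN coord_subspace_in] s(1)[THEN coord_subspace_in]
  have exps: "lie_exp cartan cartan.M (X 1 1) = p" "lie_exp cartan cartan.M (X 1 2) = q"
    "lie_exp cartan cartan.M (X 2 1) = s"
    using in5 by (simp_all only: p q s cartan_exp)

  have "area p q \<noteq> 0"
  proof -
    have comb: "\<exists>a b. \<forall>k<5. v k = a * p k + b * q k" if "v \<in> coord_subspace 5 (layer_coords 1)" for v
    proof -
      have "{X 1 i | i. i \<in> {1..oper.dim (layer 1)}} = {X 1 1, X 1 2}"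
        unfolding dims by auto
      then have "cartan.left_field v \<in> oper.span {X 1 1, X 1 2}"
        using span[of 1] that by (simp add: layer_def)
      then obtain a b where "cartan.left_field v - oper_scale a (X 1 1) = oper_scale b (X 1 2)"
        by (auto simp: oper.span_insert oper.span_singleton)
      then have "cartan.left_field v = oper_scale a (X 1 1) + oper_scale b (X 1 2)"
        by (simp add: algebra_simps)
      then show ?thesis
        unfolding p q cartan.left_field_scale cartan.left_field_add cartan.left_field_inject by blast
    qed
    have u01: "coord_unit 0 \<in> coord_subspace 5 (layer_coords 1)" "coord_unit 1 \<in> coord_subspace 5 (layer_coords 1)"
      by (auto intro!: coord_unit_in simp: layer_coords_def)
    obtain a b where ab: "\<And>k. k < 5 \<Longrightarrow> coord_unit 0 k = a * p k + b * q k"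
      using comb[OF u01(1)] by blast
    obtain c d where cd: "\<And>k. k < 5 \<Longrightarrow> coord_unit 1 k = c * p k + d * q k"
      using comb[OF u01(2)] by blast
    \<comment> \<open>The determinant of the two unit vectors, written through their expansions in
      \<open>p\<close> and \<open>q\<close>; it factors through \<open>area p q\<close>.\<close>
    have "(a * p 0 + b * q 0) * (c * p 1 + d * q 1) - (a * p 1 + b * q 1) * (c * p 0 + d * q 0) = 1"
      using ab[of 0] ab[of 1] cd[of 0] cd[of 1] by (simp add: coord_unit_def flip: ab cd)
    then have "(a * d - b * c) * area p q = 1"
      by (simp add: area_def algebra_simps)
    then show ?thesis by auto
  qed

  define G' where "G' = generate cartan {p, q}"
  define S where "S = {lie_exp cartan cartan.M (X k i) | k i. k \<in> {2..3} \<and> i \<in> {1..oper.dim (layer k)}}"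
  have "{lie_exp cartan cartan.M (X 1 i) | i. i \<in> {1..oper.dim (layer 1)}} = {p, q}"
    unfolding dims exps[symmetric] by auto
  with bspec[OF inter, of 2] have G2: "G' \<inter> lie_exp cartan cartan.M ` oper.span (\<Union>k\<in>{2..3}. layer k) = generate cartan S"
    unfolding G'_def S_def by simp

  define c where "c = cartan_mult (cartan_mult (cartan_mult p q) (\<lambda>i. - p i)) (\<lambda>i. - q i)"
  have layer: "p 2 = 0" "q 2 = 0"
    using p q by (auto simp: coord_subspace_def layer_coords_def)
  have c: "c 0 = 0" "c 1 = 0" "c 2 = area p q"
    by (simp_all add: c_def cartan_mult_def area_def layer field_simps)
  have "c = ((p \<otimes>\<^bsub>cartan\<^esub> q) \<otimes>\<^bsub>cartan\<^esub> inv\<^bsub>cartan\<^esub> p) \<otimes>\<^bsub>cartan\<^esub> inv\<^bsub>cartan\<^esub> q"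
    using in5 by (simp add: c_def cartan_inv)
  also have "\<dots> \<in> G'"
    unfolding G'_def by (intro generate.eng) (auto intro: generate.incl generate.inv)
  finally have "c \<in> G'" .
  moreover have c5: "c \<in> coord_space 5"
    using in5 unfolding c_def by (intro cartan_mult_in) (auto simp: coord_space_def)
  have "cartan.left_field c \<in> oper.span (\<Union>k\<in>{2..3}. layer k)"
  proof (rule left_field_in_span_layers[OF c5])
    fix i :: nat assume "i < 5" "i \<notin> (\<Union>j\<in>{2..3}. layer_coords j)"
    then have "i < 5" "i \<notin> layer_coords 2" "i \<notin> layer_coords 3"
      by auto
    then have "i = 0 \<or> i = 1"
      by (auto simp: layer_coords_def)
    then show "c i = 0" using c by auto
  qed
  then have "c \<in> lie_exp cartan cartan.M ` oper.span (\<Union>k\<in>{2..3}. layer k)"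
    using cartan_exp[OF c5] by (metis imageI)
  ultimately have "c \<in> generate cartan S"
    using G2 by blast
  moreover have "generate cartan S \<subseteq> {v \<in> coord_space 5. v 0 = 0 \<and> v 1 = 0 \<and> (\<exists>k\<in>\<int>. v 2 = k * s 2)}"
  proof (rule group.generate_subgroup_incl[OF group_cartan _ subgroup_integral_height], safe)
    fix x assume "x \<in> S"
    then obtain k i where k: "k \<in> {2..3}" "i \<in> {1..oper.dim (layer k)}"
      and x: "x = lie_exp cartan cartan.M (X k i)"
      unfolding S_def by blast
    have "X k i \<in> layer k" using X k by simp
    then obtain v where v: "v \<in> coord_subspace 5 (layer_coords k)" "X k i = cartan.left_field v"
      unfolding layer_def by blast
    have xv: "x = v"
      unfolding x v(2) by (rule cartan_exp[OF coord_subspace_in[OF v(1)]])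
    show "x \<in> coord_space 5" using v(1) xv coord_subspace_in by blast
    consider "k = 2" | "k = 3" using k by force
    then have "x 0 = 0 \<and> x 1 = 0 \<and> (\<exists>k\<in>\<int>. x 2 = k * s 2)"
    proof cases
      case 1
      then have "i = 1" using k(2) dims(2) by blast
      with 1 have "x = s" using x exps(3) by simp
      then show ?thesis
        using s(1) by (auto simp: coord_subspace_def layer_coords_def intro!: bexI[of _ 1])
    next
      case 2
      then show ?thesis
        using v(1) xv by (auto simp: coord_subspace_def layer_coords_def intro!: bexI[of _ 0])
    qed
    then show "x 0 = 0" "x 1 = 0" "\<exists>k\<in>\<int>. x 2 = k * s 2" by auto
  qed
  ultimately obtain k where k: "k \<in> \<int>" "area p q = k * s 2"
    using c by auto

  have "s \<in> S" unfolding S_def exps(3)[symmetric] using mem(3) by force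
  then have "s \<in> generate cartan S"
    by (rule generate.incl)
  then have "s \<in> G'"
    unfolding G2[symmetric] by (rule IntD1)
  then have "s \<in> lattice_hull p q"
    unfolding G'_def by (rule generate_in_lattice_hull[OF p(1) q(1)])
  then obtain i j k' l where k'_l: "k' \<in> \<int>" "l \<in> \<int>" and ij: "s 0 = i * p 0 + j * q 0" "s 1 = i * p 1 + j * q 1"
    and k': "s 2 = area p q * (i * j / 2 + k')"
    and l: "s 3 * q 1 - s 4 * q 0 = (area p q)\<^sup>2 * (i\<^sup>2 * j / 12 + k' * (1 + i) / 2 + l)"
    unfolding lattice_hull_def by blast
  have s0: "s 0 = 0" "s 1 = 0" "s 3 = 0" "s 4 = 0"
    using s(1) by (auto simp: coord_subspace_def layer_coords_def)
  \<comment> \<open>Cramer's rule for the first two coordinates, both 0 for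
    \<open>s\<close>.\<close>
  have "i * area p q = s 0 * q 1 - s 1 * q 0" "j * area p q = s 1 * p 0 - s 0 * p 1"
    unfolding ij by (simp_all add: area_def algebra_simps)
  then have "i = 0" "j = 0"
    using \<open>area p q \<noteq> 0\<close> s0 by auto
  \<comment> \<open>At i = j = 0 the pairing reads k' / 2 + l = 0, since \<open>s\<close> has no
    central part; here the half-integer forces evenness.\<close>
  then have height: "s 2 = area p q * k'" and even: "k' = - 2 * l"
    using k' l s0 \<open>area p q \<noteq> 0\<close> by auto
  \<comment> \<open>Substituting one height relation into the other leaves an odd integer equal to
    0.\<close>
  have "area p q = k * (area p q * (- 2 * l))"
    using k(2) unfolding height even .
  then have "area p q * (1 + 2 * k * l) = 0"
    by (simp add: algebra_simps)
  then have "1 + 2 * k * l = 0"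
    using \<open>area p q \<noteq> 0\<close> by simp
  moreover obtain a b where "k = of_int a" "l = of_int b"
    using k(1) k'_l(2) by (auto elim!: Ints_cases)
  ultimately have "of_int (1 + 2 * a * b) = (0 :: real)"
    by simp
  then have "1 + 2 * a * b = 0"
    unfolding of_int_eq_0_iff .
  then have "even (1 + 2 * a * b)"
    by (simp only: dvd_0_right)
  then show False
    by simp
qed

theorem proposition2p2:
  shows "\<exists>(G :: (nat \<Rightarrow> real) monoid) M r V.
           carnot_group G M r V \<and> \<not> discretizable G M r V"
  using carnot_group_cartan not_discretizable_cartan by blast

end
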